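(* Let $(a_n)_{n\ge1}$ be defined by $a_1=1$ and $a_n=a_{n-1}+\operatorname{lcm}(n,a_{n-1})$ for $n\ge2$, and for $n\ge2$ let $b_n=\frac{n}{\gcd(n,a_{n-1})}$. Then the set of integers $n\ge2$ for which $b_n\in\{1\}\cup\mathbb{P}$ has asymptotic density $1$.
   Context: $\mathbb{P}$ denotes the set of prime numbers. Asymptotic density $1$ means that the number of $n\le x$ in the set is $x-o(x)$ as $x\to\infty$. *)

theory Defs
  imports Complex_Main "HOL-Library.Landau_Symbols" "HOL-Computational_Algebra.Primes"
begin

(* The sequence starts at index 1; the value at 0 is a dummy and is never used below. *)
fun a_seq :: "nat \<Rightarrow> nat" where
  "a_seq 0 = 0"
| "a_seq (Suc 0) = 1"
| "a_seq (Suc (Suc n)) = a_seq (Suc n) + lcm (Suc (Suc n)) (a_seq (Suc n))"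

(* Meant for n \<ge> 2. The division is exact, since the gcd divides n. *)
definition b_seq :: "nat \<Rightarrow> nat" where
  "b_seq n = n div gcd n (a_seq (n - 1))"

definition asymptotic_density_one :: "nat set \<Rightarrow> bool" where
  "asymptotic_density_one A \<longleftrightarrow>
     (\<lambda>x::real. x - real (card {n \<in> A. real n \<le> x})) \<in> o[at_top](\<lambda>x. x)"

end

theory Submission
  imports Defs "HOL-Number_Theory.Number_Theory" "HOL-Real_Asymp.Real_Asymp"
begin

text \<open>
  Since \<open>a\<^sub>n = a\<^sub>n\<^sub>-\<^sub>1 (1 + b\<^sub>n)\<close>, the terms form a chain of divisors. If \<open>b\<^sub>n\<close> is neither \<open>1\<close> nor prime,
  then \<open>q p\<close> divides \<open>b\<^sub>n\<close> for some primes \<open>q \<le> p\<close>, so \<open>q \<le> \<surd>n\<close> and \<open>q\<close> divides \<open>n\<close> more often than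
  \<open>a\<^sub>n\<^sub>-\<^sub>1\<close>. Small \<open>q\<close> are harmless: \<open>b\<^sub>r = r\<close> for all primes \<open>r > 3\<close>, and there are infinitely many
  primes \<open>r\<close> congruent to \<open>-1\<close> modulo \<open>q\<close>, so every power of \<open>q\<close> eventually divides \<open>a\<^sub>n\<close>. Up to
  numbers with a large square factor, what remains is to bound the sum of \<open>1/q\<close> over the large primes
  \<open>q \<le> \<surd>n\<close> in the set \<open>U\<close> of primes not dividing \<open>a\<^sub>X\<close>, where \<open>X = \<epsilon> n\<close>.

  Information on primes in progressions is not needed here, because \<open>U\<close> obstructs itself: every product
  \<open>k \<le> X\<close> of primes in \<open>U\<close> is coprime to \<open>a\<^sub>k\<^sub>-\<^sub>1\<close>, so \<open>b\<^sub>k = k\<close>, and \<open>k + 1\<close> divides \<open>a\<^sub>X\<close>; thus no prime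
  in \<open>U\<close> divides \<open>k + 1\<close>. If \<open>U\<close> has many elements in the dyadic block of \<open>y\<close>, the large sieve then
  bounds any set of numbers \<open>a\<close> with all \<open>a q\<close> of this kind by roughly \<open>y\<close> elements. Applied to
  products of two primes in the block this forces \<open>8 y\<^sup>3 > X\<close>, and applied to a second rich block at \<open>z\<close> it
  forces \<open>z \<le> y\<^bsup>1+\<delta>\<^esup>\<close>. Hence the rich blocks below \<open>\<surd>X\<close> lie in a single window, which contributes \<open>O(\<delta>)\<close>
  by Chebyshev's bound.
\<close>

section \<open>The linear large sieve\<close>

text \<open>Up to reflection, this is convolution with the indicator of an interval of length
  \<open>m\<close>; iterating it yields a smooth weight in place of a sharp cutoff.\<close>

definition window_sum :: "nat \<Rightarrow> (int \<Rightarrow> real) \<Rightarrow> int \<Rightarrow> real" where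
  "window_sum m F s = (\<Sum>i<m. F (s + int i))"

lemma window_sum_sum:
  "window_sum m (\<lambda>n. \<Sum>x\<in>S. F x n) = (\<lambda>n. \<Sum>x\<in>S. window_sum m (F x) n)"
  unfolding window_sum_def fun_eq_iff by (intro allI sum.swap)

lemma funpow_window_sum_sum:
  "(window_sum m ^^ k) (\<lambda>n. \<Sum>x\<in>S. F x n) = (\<lambda>n. \<Sum>x\<in>S. (window_sum m ^^ k) (F x) n)"
  by (induction k) (simp_all add: window_sum_sum)

lemma abs_funpow_window_sum_le:
  assumes "\<And>n. \<bar>F n\<bar> \<le> c"
  shows "\<bar>(window_sum m ^^ k) F s\<bar> \<le> real m ^ k * c"
proof (induction k arbitrary: s)
  case (Suc k)
  have "\<bar>(window_sum m ^^ Suc k) F s\<bar> \<le> (\<Sum>i<m. \<bar>(window_sum m ^^ k) F (s + int i)\<bar>)"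
    by (simp add: window_sum_def sum_abs)
  also have "\<dots> \<le> (\<Sum>i<m. real m ^ k * c)"
    by (intro sum_mono Suc.IH)
  finally show ?case by (simp add: algebra_simps)
qed (use assms in simp)

lemma funpow_window_sum_nonneg:
  assumes "\<And>n. 0 \<le> F n"
  shows "0 \<le> (window_sum m ^^ k) F s"
  by (induction k arbitrary: s) (auto simp: window_sum_def assms intro!: sum_nonneg)

text \<open>Each \<open>n\<close> in \<open>{0..<z}\<close> is counted with total weight
  \<open>m ^ k\<close>, because the iterated window extends at most \<open>k * m\<close> to the
  right of its starting point \<open>s\<close>.\<close>

lemma sum_le_sum_funpow_window_sum:
  fixes F :: "int \<Rightarrow> real"
  assumes "\<And>n. 0 \<le> F n"
  shows "real m ^ k * (\<Sum>n\<in>{0..<z}. F n) \<le> (\<Sum>s\<in>{- int (k * m)..<z}. (window_sum m ^^ k) F s)"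
proof (induction k)
  case (Suc k)
  define G where "G = (window_sum m ^^ k) F"
  have Gpos: "0 \<le> G n" for n
    unfolding G_def by (rule funpow_window_sum_nonneg[OF assms])
  have shift: "(\<Sum>n\<in>{- int (k * m)..<z}. G n) \<le> (\<Sum>s\<in>{- int (Suc k * m)..<z}. G (s + int i))"
    if "i < m" for i
  proof -
    have "(\<Sum>s\<in>{- int (Suc k * m)..<z}. G (s + int i))
        = (\<Sum>n\<in>(\<lambda>s. s + int i) ` {- int (Suc k * m)..<z}. G n)"
      by (subst sum.reindex) (auto simp: inj_on_def)
    moreover have "{- int (k * m)..<z} \<subseteq> (\<lambda>s. s + int i) ` {- int (Suc k * m)..<z}"
    proof
      fix n assume "n \<in> {- int (k * m)..<z}"
      then have "n - int i \<in> {- int (Suc k * m)..<z}" using that by (auto simp: algebra_simps)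
      then show "n \<in> (\<lambda>s. s + int i) ` {- int (Suc k * m)..<z}"
        by (intro image_eqI[of _ _ "n - int i"]) auto
    qed
    ultimately show ?thesis
      by (auto intro!: sum_mono2 Gpos)
  qed
  have "real m ^ Suc k * (\<Sum>n\<in>{0..<z}. F n) \<le> real m * (\<Sum>n\<in>{- int (k * m)..<z}. G n)"
    using Suc.IH by (simp add: G_def mult.assoc mult_left_mono)
  also have "\<dots> = (\<Sum>i<m. \<Sum>n\<in>{- int (k * m)..<z}. G n)"
    by simp
  also have "\<dots> \<le> (\<Sum>i<m. \<Sum>s\<in>{- int (Suc k * m)..<z}. G (s + int i))"
    by (intro sum_mono shift) auto
  also have "\<dots> = (\<Sum>s\<in>{- int (Suc k * m)..<z}. (window_sum m ^^ Suc k) F s)"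
    by (subst sum.swap) (simp add: G_def window_sum_def)
  finally show ?case .
qed simp

lemma sum_lessThan_split_shift:
  fixes f :: "nat \<Rightarrow> real"
  assumes "d \<le> m"
  shows "(\<Sum>i<m. f i) = (\<Sum>i<d. f i) + (\<Sum>i<m-d. f (i + d))"
proof -
  have "(\<Sum>i<m. f i) = (\<Sum>i<d. f i) + (\<Sum>i\<in>{d..<m}. f i)"
    using assms by (metis atLeast0LessThan le0 sum.atLeastLessThan_concat)
  also have "(\<Sum>i\<in>{d..<m}. f i) = (\<Sum>i<m-d. f (i + d))"
    using assms sum.shift_bounds_nat_ivl[of f 0 d "m - d"] by (simp add: lessThan_atLeast0)
  finally show ?thesis .
qed

text \<open>Complete windows of length \<open>d\<close> contribute nothing, which leaves fewer than
  \<open>d\<close> terms. The assumption \<open>zero\<close> encodes periodicity modulo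
  \<open>d\<close> together with mean zero.\<close>

lemma abs_window_sum_periodic_le:
  fixes G :: "int \<Rightarrow> real"
  assumes zero: "\<And>s. window_sum d G s = 0" and bound: "\<And>n. \<bar>G n\<bar> \<le> c" and "d > 0"
  shows "\<bar>window_sum m G s\<bar> \<le> real d * c"
proof (induction m arbitrary: s rule: less_induct)
  case (less m)
  have "c \<ge> 0" using bound[of 0] by linarith
  show ?case
  proof (cases "d \<le> m")
    case True
    have "window_sum m G s = window_sum d G s + window_sum (m - d) G (s + int d)"
      using sum_lessThan_split_shift[OF True, of "\<lambda>i. G (s + int i)"]
      by (simp add: window_sum_def algebra_simps)
    then show ?thesis using less.IH[of "m - d"] True \<open>d > 0\<close> by (simp add: zero)
  next
    case False
    have "\<bar>window_sum m G s\<bar> \<le> (\<Sum>i<m. c)"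
      unfolding window_sum_def by (rule order_trans[OF sum_abs]) (intro sum_mono bound)
    also have "\<dots> \<le> real d * c"
      using False \<open>c \<ge> 0\<close> by (simp add: mult_right_mono)
    finally show ?thesis .
  qed
qed

text \<open>Summing over a window preserves the vanishing of the \<open>d\<close>-windows, so each
  iteration costs \<open>d\<close> rather than \<open>m\<close>.\<close>

lemma abs_funpow_window_sum_periodic_le:
  fixes G :: "int \<Rightarrow> real"
  assumes zero: "\<And>s. window_sum d G s = 0" and bound: "\<And>n. \<bar>G n\<bar> \<le> c" and "d > 0"
  shows "\<bar>(window_sum m ^^ k) G s\<bar> \<le> real d ^ k * c"
proof -
  have "(\<forall>s. window_sum d ((window_sum m ^^ k) G) s = 0) \<and>
        (\<forall>s. \<bar>(window_sum m ^^ k) G s\<bar> \<le> real d ^ k * c)"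
  proof (induction k)
    case (Suc k)
    define H where "H = (window_sum m ^^ k) G"
    have "window_sum d (window_sum m H) s = 0" for s
    proof -
      have "window_sum d (window_sum m H) s = (\<Sum>j<m. window_sum d H (s + int j))"
        unfolding window_sum_def by (subst sum.swap) (simp add: algebra_simps)
      then show ?thesis using Suc.IH by (simp add: H_def)
    qed
    moreover have "\<bar>window_sum m H s\<bar> \<le> real d * (real d ^ k * c)" for s
      by (rule abs_window_sum_periodic_le) (use Suc.IH \<open>d > 0\<close> in \<open>auto simp: H_def\<close>)
    ultimately show ?case by (simp add: H_def algebra_simps)
  qed (use assms in auto)
  then show ?thesis by blast
qed

text \<open>Subtracting the density gives mean zero over a period, while on integers avoiding
  \<open>H\<close> the value is a nonpositive constant.\<close>

definition residue_dev :: "nat \<Rightarrow> int set \<Rightarrow> int \<Rightarrow> real" where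
  "residue_dev p H n = of_bool (n mod int p \<in> H) - real (card H) / real p"

lemma abs_residue_dev_le:
  assumes "H \<subseteq> {0..<int p}" "p > 0"
  shows "\<bar>residue_dev p H n\<bar> \<le> 1"
proof -
  have "card H \<le> p" using card_mono[OF _ assms(1)] by simp
  then have "real (card H) / real p \<le> 1" "real (card H) / real p \<ge> 0" using assms(2) by (auto simp: field_simps)
  then show ?thesis by (auto simp: residue_dev_def)
qed

text \<open>As \<open>r\<close> is invertible modulo \<open>p\<close>, the progression meets every
  residue class exactly once.\<close>

lemma sum_residue_dev_progression:
  assumes H: "H \<subseteq> {0..<int p}" and "p > 0" and cop: "coprime (int r) (int p)"
  shows "(\<Sum>b<p. residue_dev p H (s + int r * int b)) = 0"
proof -
  define f where "f = (\<lambda>b::nat. (s + int r * int b) mod int p)"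
  have inj: "inj_on f {..<p}"
  proof (rule inj_onI)
    fix a b assume ab: "a \<in> {..<p}" "b \<in> {..<p}" "f a = f b"
    then have "[s + int r * int a = s + int r * int b] (mod int p)"
      by (simp add: f_def unique_euclidean_semiring_class.cong_def)
    then have "[int a = int b] (mod int p)"
      using cop by (metis cong_add_lcancel cong_mult_lcancel)
    then show "a = b" using ab cong_less_imp_eq_int[of "int a" "int p" "int b"] by simp
  qed
  have img: "f ` {..<p} = {0..<int p}"
  proof (rule card_subset_eq)
    show "f ` {..<p} \<subseteq> {0..<int p}" using \<open>p > 0\<close> by (auto simp: f_def)
    show "card (f ` {..<p}) = card {0..<int p}" using inj by (simp add: card_image)
  qed simp
  have "(\<Sum>b<p. of_bool (f b \<in> H) :: real) = (\<Sum>h\<in>{0..<int p}. of_bool (h \<in> H))"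
    unfolding img[symmetric] by (subst sum.reindex[OF inj]) simp
  also have "\<dots> = real (card H)"
    using H by (simp add: Int_absorb1 flip: Collect_conj_eq)
  finally show ?thesis using \<open>p > 0\<close>
    by (simp add: residue_dev_def sum_subtractf f_def)
qed

lemma residue_dev_periodic: "residue_dev p H (n + int p * j) = residue_dev p H n"
  by (simp add: residue_dev_def)

text \<open>Write the index as \<open>a + p * b\<close>: the first factor depends on
  \<open>a\<close> only, and for fixed \<open>a\<close> the second one sums to zero over
  \<open>b\<close>.\<close>

lemma window_sum_residue_dev_mult:
  assumes H: "H' \<subseteq> {0..<int p'}" "p' > 0" and cop: "coprime p p'"
  shows "window_sum (p * p') (\<lambda>n. residue_dev p H n * residue_dev p' H' n) s = 0"
proof -
  let ?G = "\<lambda>n. residue_dev p H n * residue_dev p' H' n"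
  have "window_sum (p * p') ?G s = (\<Sum>b<p'. \<Sum>i\<in>{b*p..<b*p+p}. ?G (s + int i))"
    unfolding window_sum_def by (subst sum.nat_group) (simp add: mult.commute)
  also have "\<dots> = (\<Sum>b<p'. \<Sum>a<p. ?G ((s + int a) + int p * int b))"
  proof (rule sum.cong[OF refl])
    fix b
    show "(\<Sum>i\<in>{b*p..<b*p+p}. ?G (s + int i)) = (\<Sum>a<p. ?G ((s + int a) + int p * int b))"
      using sum.shift_bounds_nat_ivl[of "\<lambda>i. ?G (s + int i)" 0 "b*p" p]
      by (simp add: lessThan_atLeast0 algebra_simps)
  qed
  also have "\<dots> = (\<Sum>a<p. residue_dev p H (s + int a) * (\<Sum>b<p'. residue_dev p' H' ((s + int a) + int p * int b)))"
    by (subst sum.swap) (simp add: residue_dev_periodic sum_distrib_left)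
  also have "\<dots> = 0"
    using sum_residue_dev_progression[OF H, of p] cop by simp
  finally show ?thesis .
qed

text \<open>
  Counting in the \<open>k\<close>-fold iterated window instead of an interval makes the off-diagonal terms
  negligible: for \<open>p \<noteq> p'\<close> the summand is periodic modulo \<open>p p'\<close> with mean zero, so each iteration
  costs a factor \<open>p p'\<close> only, against \<open>m\<close> on the diagonal.
\<close>

lemma linear_large_sieve:
  fixes P :: "nat set" and A :: "int set" and H :: "nat \<Rightarrow> int set" and z :: nat
  assumes fin: "finite P" and A: "A \<subseteq> {0..<int z}"
    and pos: "\<And>p. p \<in> P \<Longrightarrow> p > 0" and H: "\<And>p. p \<in> P \<Longrightarrow> H p \<subseteq> {0..<int p}"
    and avoid: "\<And>a p. a \<in> A \<Longrightarrow> p \<in> P \<Longrightarrow> a mod int p \<notin> H p"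
    and cop: "\<And>p p'. p \<in> P \<Longrightarrow> p' \<in> P \<Longrightarrow> p \<noteq> p' \<Longrightarrow> coprime p p' \<and> p * p' \<le> D"
    and t: "card P \<le> t ^ k" and "D > 0" "t > 0"
  shows "real (card A) * (\<Sum>p\<in>P. real (card (H p)) / real p)\<^sup>2 \<le> real (k * D * t + z) * (2 * real (card P))"
proof -
  define m where "m = D * t"
  define W where "W = (\<Sum>p\<in>P. real (card (H p)) / real p)"
  define g where "g = (\<lambda>p. residue_dev p (H p))"
  define f where "f = (\<lambda>n. \<Sum>p\<in>P. g p n)"
  have "m > 0" using assms by (simp add: m_def)
  have g1: "\<bar>g p n\<bar> \<le> 1" if "p \<in> P" for p n
    unfolding g_def by (rule abs_residue_dev_le) (use that H pos in auto)
  have gg1: "\<bar>g p n * g q n\<bar> \<le> 1" if "p \<in> P" "q \<in> P" for p q n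
    using mult_mono[OF g1[OF that(1), of n] g1[OF that(2), of n]] by (simp add: abs_mult)
  \<comment> \<open>Every \<open>p\<close> in \<open>P\<close> contributes its constant value on
    \<open>A\<close>, so the second moment of \<open>f\<close> detects the size of
    \<open>A\<close>.\<close>
  have fA: "(f n)\<^sup>2 = W\<^sup>2" if "n \<in> A" for n
  proof -
    have "f n = - W"
      using avoid[OF that] by (simp add: f_def g_def W_def residue_dev_def sum_negf)
    then show ?thesis by simp
  qed
  have sq: "(\<lambda>n. (f n)\<^sup>2) = (\<lambda>n. \<Sum>x\<in>P \<times> P. (\<lambda>(p, q) n. g p n * g q n) x n)"
    by (simp add: f_def power2_eq_square sum_product sum.cartesian_product case_prod_beta)
  have offdiag: "\<bar>(window_sum m ^^ k) (\<lambda>n. g p n * g q n) s\<bar> \<le> real D ^ k"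
    if "p \<in> P" "q \<in> P" "p \<noteq> q" for p q s
  proof -
    have "\<bar>(window_sum m ^^ k) (\<lambda>n. g p n * g q n) s\<bar> \<le> real (p * q) ^ k * 1"
    proof (rule abs_funpow_window_sum_periodic_le)
      show "window_sum (p * q) (\<lambda>n. g p n * g q n) s = 0" for s
        unfolding g_def by (rule window_sum_residue_dev_mult) (use that H pos cop in auto)
    qed (use that gg1 pos in auto)
    also have "\<dots> \<le> real D ^ k * 1"
      by (intro mult_right_mono power_mono) (use cop[OF that] in \<open>auto simp flip: of_nat_mult\<close>)
    finally show ?thesis by simp
  qed
  have pair: "(window_sum m ^^ k) (\<lambda>n. g p n * g q n) s \<le> (if p = q then real m ^ k else real D ^ k)"
    if "p \<in> P" "q \<in> P" for p q s
  proof (cases "p = q")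
    case True
    then show ?thesis
      using abs_funpow_window_sum_le[where F = "\<lambda>n. g p n * g q n" and m = m and k = k and c = 1 and s = s,
          OF gg1[OF that]] by simp
  next
    case False
    then show ?thesis using offdiag[OF that False, of s] by simp
  qed
  have bd: "(window_sum m ^^ k) (\<lambda>n. (f n)\<^sup>2) s \<le> real m ^ k * (2 * real (card P))" for s
  proof -
    have "(window_sum m ^^ k) (\<lambda>n. (f n)\<^sup>2) s
        = (\<Sum>x\<in>P \<times> P. (window_sum m ^^ k) ((\<lambda>(p, q) n. g p n * g q n) x) s)"
      unfolding sq funpow_window_sum_sum ..
    also have "\<dots> = (\<Sum>p\<in>P. \<Sum>q\<in>P. (window_sum m ^^ k) (\<lambda>n. g p n * g q n) s)"
      by (simp add: sum.cartesian_product case_prod_beta)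
    also have "\<dots> \<le> (\<Sum>p\<in>P. \<Sum>q\<in>P. (if p = q then real m ^ k else 0) + real D ^ k)"
      by (intro sum_mono order_trans[OF pair]) auto
    also have "\<dots> = real (card P) * real m ^ k + real (card P) * (real (card P) * real D ^ k)"
      using fin by (simp add: sum.distrib algebra_simps)
    \<comment> \<open>The hypothesis on \<open>t\<close> lets the diagonal absorb the off-diagonal
      pairs: \<open>card P * D ^ k\<close> is at most \<open>(t * D) ^ k\<close>.\<close>
    also have "\<dots> \<le> real (card P) * real m ^ k + real (card P) * real m ^ k"
    proof (intro add_left_mono mult_left_mono)
      have "real (card P) \<le> real t ^ k" using t by (simp flip: of_nat_power)
      then have "real (card P) * real D ^ k \<le> real t ^ k * real D ^ k"
        by (intro mult_right_mono) auto
      then show "real (card P) * real D ^ k \<le> real m ^ k"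
        by (simp add: m_def power_mult_distrib mult.commute)
    qed simp
    finally show ?thesis by (simp add: algebra_simps)
  qed
  have "real (card A) * W\<^sup>2 = (\<Sum>n\<in>A. (f n)\<^sup>2)"
    by (simp add: fA)
  also have "\<dots> \<le> (\<Sum>n\<in>{0..<int z}. (f n)\<^sup>2)"
    by (intro sum_mono2 A) auto
  finally have "real m ^ k * (real (card A) * W\<^sup>2) \<le> real m ^ k * (\<Sum>n\<in>{0..<int z}. (f n)\<^sup>2)"
    by (intro mult_left_mono) auto
  also have "\<dots> \<le> (\<Sum>s\<in>{- int (k * m)..<int z}. (window_sum m ^^ k) (\<lambda>n. (f n)\<^sup>2) s)"
    by (rule sum_le_sum_funpow_window_sum) auto
  also have "\<dots> \<le> (\<Sum>s\<in>{- int (k * m)..<int z}. real m ^ k * (2 * real (card P)))"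
    by (intro sum_mono bd)
  also have "\<dots> = real m ^ k * (real (k * m + z) * (2 * real (card P)))"
    by (simp add: nat_add_distrib flip: of_nat_mult of_nat_add)
  finally have "real (card A) * W\<^sup>2 \<le> real (k * m + z) * (2 * real (card P))"
    using \<open>m > 0\<close> by simp
  then show ?thesis by (simp add: W_def m_def mult.assoc)
qed

section \<open>Primes congruent to $-1$ modulo a prime\<close>

text \<open>The coordinates of \<open>(u + \<surd>D)\<^sup>n\<close> with respect to \<open>1\<close> and \<open>\<surd>D\<close>.\<close>

fun quad_x quad_u :: "int \<Rightarrow> int \<Rightarrow> nat \<Rightarrow> int" where
  "quad_x u D 0 = 1"
| "quad_x u D (Suc n) = u * quad_x u D n + D * quad_u u D n"
| "quad_u u D 0 = 0"
| "quad_u u D (Suc n) = quad_x u D n + u * quad_u u D n"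

section \<open>Lucas sequences: addition law, norm and congruences\<close>

lemma quad_add:
  "quad_x u D (m + n) = quad_x u D m * quad_x u D n + D * quad_u u D m * quad_u u D n \<and>
   quad_u u D (m + n) = quad_x u D m * quad_u u D n + quad_u u D m * quad_x u D n"
  by (induction m) (auto simp: algebra_simps)

lemma quad_norm: "(quad_x u D n)\<^sup>2 - D * (quad_u u D n)\<^sup>2 = (u\<^sup>2 - D) ^ n"
proof (induction n)
  case (Suc n)
  have "(quad_x u D (Suc n))\<^sup>2 - D * (quad_u u D (Suc n))\<^sup>2
      = (u\<^sup>2 - D) * ((quad_x u D n)\<^sup>2 - D * (quad_u u D n)\<^sup>2)"
    by (simp add: algebra_simps power2_eq_square)
  then show ?case by (simp add: Suc)
qed simp

lemma quad_pos:
  assumes "u > 0" "D > 0"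
  shows "quad_x u D n > 0 \<and> quad_u u D n \<ge> 0 \<and> quad_u u D (Suc n) > 0"
  using assms by (induction n) (auto intro!: add_pos_nonneg mult_pos_pos mult_nonneg_nonneg simp: less_imp_le)

text \<open>Modulo \<open>u\<close>, the number \<open>u + sqrt D\<close> reduces to
  \<open>sqrt D\<close>, whose odd powers are \<open>D ^ i * sqrt D\<close>.\<close>

lemma quad_u_odd_cong: "[quad_u u D (Suc (2 * i)) = D ^ i] (mod u)"
proof (induction i)
  case (Suc i)
  have "quad_u u D (Suc (2 * Suc i)) = D * quad_u u D (Suc (2 * i)) + u * (quad_u u D (Suc (Suc (2 * i))) + quad_x u D (Suc (2*i)))"
    by (simp add: algebra_simps)
  then have "[quad_u u D (Suc (2 * Suc i)) = D * quad_u u D (Suc (2 * i))] (mod u)"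
    by (simp add: unique_euclidean_semiring_class.cong_def)
  also have "[D * quad_u u D (Suc (2 * i)) = D * D ^ i] (mod u)"
    by (intro cong_mult cong_refl Suc.IH)
  finally show ?case by simp
qed simp

text \<open>Modulo \<open>D\<close>, the square of \<open>sqrt D\<close> vanishes, so only the first
  two binomial terms survive.\<close>

lemma quad_u_cong_mod_D: "[quad_x u D n = u ^ n] (mod D) \<and> [quad_u u D (Suc n) = int (Suc n) * u ^ n] (mod D)"
proof (induction n)
  case (Suc n)
  have "[D * quad_u u D n = 0] (mod D)" by (simp add: cong_0_iff)
  then have x: "[quad_x u D (Suc n) = u * u ^ n + 0] (mod D)"
    unfolding quad_x.simps by (intro cong_add cong_scalar_left conjunct1[OF Suc])
  then have "[quad_u u D (Suc (Suc n)) = (u * u ^ n + 0) + u * (int (Suc n) * u ^ n)] (mod D)"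
    unfolding quad_u.simps(2)[of u D "Suc n"]
    by (intro cong_add cong_scalar_left conjunct2[OF Suc])
  with x show ?case by (simp add: algebra_simps del: quad_x.simps quad_u.simps)
qed simp

text \<open>A vanishing norm gives \<open>(u + sqrt D)^2 = 2 * u * (u + sqrt D)\<close> modulo
  \<open>p\<close>.\<close>

lemma quad_u_cong_of_dvd_norm:
  assumes "[u\<^sup>2 = D] (mod p)"
  shows "[quad_u u D (Suc n) = (2 * u) ^ n] (mod p)"
proof (induction n)
  case (Suc n)
  have "[D * quad_u u D n = u\<^sup>2 * quad_u u D n] (mod p)"
    by (intro cong_mult cong_refl) (use assms in \<open>simp add: cong_sym\<close>)
  then have "[(u * quad_x u D n + u * quad_u u D (Suc n)) + D * quad_u u D n
      = (u * quad_x u D n + u * quad_u u D (Suc n)) + u\<^sup>2 * quad_u u D n] (mod p)"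
    by (intro cong_add cong_refl)
  then have "[quad_u u D (Suc (Suc n)) = (2 * u) * quad_u u D (Suc n)] (mod p)"
    by (simp add: algebra_simps power2_eq_square)
  also have "[(2 * u) * quad_u u D (Suc n) = (2 * u) * (2 * u) ^ n] (mod p)"
    by (intro cong_mult cong_refl Suc)
  finally show ?case by simp
qed simp

section \<open>Binomial expansion and the Frobenius map\<close>

definition binom_transform :: "int \<Rightarrow> (nat \<Rightarrow> int) \<Rightarrow> nat \<Rightarrow> int" where
  "binom_transform u e n = (\<Sum>i\<le>n. int (n choose i) * u ^ (n - i) * e i)"

lemma binom_transform_Suc:
  "binom_transform u e (Suc n) = u * binom_transform u e n + binom_transform u (\<lambda>i. e (Suc i)) n"
proof -
  have "binom_transform u e (Suc n) = u ^ Suc n * e 0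
      + (\<Sum>i\<le>n. int (n choose Suc i) * u ^ (n - i) * e (Suc i))
      + binom_transform u (\<lambda>i. e (Suc i)) n"
    unfolding binom_transform_def
    by (subst sum.atMost_Suc_shift) (simp add: algebra_simps sum.distrib)
  also have "u ^ Suc n * e 0 + (\<Sum>i\<le>n. int (n choose Suc i) * u ^ (n - i) * e (Suc i))
      = (\<Sum>i\<le>Suc n. int (n choose i) * u ^ (Suc n - i) * e i)"
    by (subst sum.atMost_Suc_shift) simp
  also have "\<dots> = u * binom_transform u e n"
    by (simp add: binom_transform_def sum_distrib_left Suc_diff_le algebra_simps)
  finally show ?thesis .
qed

lemma binom_transform_cmult: "binom_transform u (\<lambda>i. c * e i) n = c * binom_transform u e n"
  by (simp add: binom_transform_def sum_distrib_left algebra_simps)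

text \<open>This is the binomial theorem for \<open>(u + sqrt D)^n\<close>; the two sequences are
  the coordinates of the powers of \<open>sqrt D\<close>.\<close>

lemma quad_binom_transform:
  "quad_x u D n = binom_transform u (\<lambda>i. if even i then D ^ (i div 2) else 0) n \<and>
   quad_u u D n = binom_transform u (\<lambda>i. if even i then 0 else D ^ (i div 2)) n"
proof (induction n)
  case (Suc n)
  have "(\<lambda>i. if even (Suc i) then D ^ (Suc i div 2) else 0) = (\<lambda>i. D * (if even i then 0 else D ^ (i div 2)))"
    by (auto simp: fun_eq_iff elim!: oddE)
  moreover have "(\<lambda>i. if even (Suc i) then 0 else D ^ (Suc i div 2)) = (\<lambda>i. if even i then D ^ (i div 2) else 0)"
    by (auto simp: fun_eq_iff elim!: evenE)
  ultimately show ?case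
    using Suc by (simp only: binom_transform_Suc binom_transform_cmult quad_x.simps quad_u.simps) simp
qed (simp add: binom_transform_def)

lemma binom_transform_prime_cong:
  assumes "prime p"
  shows "[binom_transform u e p = u ^ p * e 0 + e p] (mod int p)"
proof -
  have p: "p > 0" using assms prime_gt_0_nat by blast
  then have "{..p} = insert 0 (insert p {1..<p})" by auto
  then have "binom_transform u e p = u ^ p * e 0 + (e p + (\<Sum>i\<in>{1..<p}. int (p choose i) * u ^ (p - i) * e i))"
    unfolding binom_transform_def using p by simp
  moreover have "int p dvd (\<Sum>i\<in>{1..<p}. int (p choose i) * u ^ (p - i) * e i)"
  proof (rule dvd_sum)
    fix i assume "i \<in> {1..<p}"
    then have "p dvd (p choose i)" using assms by (intro dvd_choose_prime) auto
    then have "int p dvd int (p choose i)" by simp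
    then show "int p dvd int (p choose i) * u ^ (p - i) * e i" by (intro dvd_mult2)
  qed
  ultimately show ?thesis by (simp add: cong_iff_dvd_diff)
qed

lemma fermat_theorem_int:
  assumes "prime p" "\<not> int p dvd a"
  shows "[a ^ (p - 1) = 1] (mod int p)"
proof -
  define b where "b = nat (a mod int p)"
  have b: "int b = a mod int p" using prime_gt_0_nat[OF assms(1)] by (simp add: b_def)
  then have "\<not> p dvd b" using assms(2) by (metis dvd_mod_iff dvd_refl int_dvd_int_iff)
  then have "[b ^ (p - 1) = 1] (mod p)" using assms(1) by (rule fermat_theorem[rotated])
  then have "[int (b ^ (p - 1)) = int 1] (mod int p)" by (simp only: cong_int_iff)
  then show ?thesis by (simp add: b unique_euclidean_semiring_class.cong_def power_mod)
qed

text \<open>By Frobenius, \<open>(u + sqrt D)^p\<close> is \<open>u + E * sqrt D\<close> modulo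
  \<open>p\<close>, with \<open>E\<close> equal to 1 or -1. In the first case dividing by the
  invertible \<open>u + sqrt D\<close> gives 1; in the second the power is the conjugate, and one
  more factor gives the norm. Neither result has a \<open>sqrt D\<close> component.\<close>

lemma quad_u_prime_dvd:
  assumes "prime p" "odd p" "\<not> int p dvd D" "\<not> int p dvd u\<^sup>2 - D"
  shows "int p dvd quad_u u D (p - 1) \<or> int p dvd quad_u u D (p + 1)"
proof -
  define E where "E = D ^ (p div 2)"
  have pi: "prime (int p)" using assms by simp
  have x: "[quad_x u D p = u] (mod int p)"
  proof -
    have "[quad_x u D p = u ^ p] (mod int p)"
      using binom_transform_prime_cong[OF assms(1), of u "\<lambda>i. if even i then D ^ (i div 2) else 0"] assms(2)
      by (simp add: quad_binom_transform)
    also have "[u ^ p = u] (mod int p)"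
    proof (cases "int p dvd u")
      case True
      then have "[u ^ p = 0] (mod int p)" "[u = 0] (mod int p)"
        using assms(1) by (auto simp: cong_0_iff prime_gt_0_nat intro: dvd_trans[OF _ dvd_power])
      then show ?thesis by (metis cong_sym cong_trans)
    next
      case False
      have "[u ^ (p - 1) = 1] (mod int p)"
        using fermat_theorem_int[OF assms(1) False] .
      then have "[u * u ^ (p - 1) = u * 1] (mod int p)" by (rule cong_scalar_left)
      then show ?thesis using assms(1) by (metis mult.right_neutral power_eq_if prime_gt_0_nat less_irrefl)
    qed
    finally show ?thesis .
  qed
  have u: "[quad_u u D p = E] (mod int p)"
    using binom_transform_prime_cong[OF assms(1), of u "\<lambda>i. if even i then 0 else D ^ (i div 2)"] assms(2)
    by (simp add: quad_binom_transform E_def)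
  have "E\<^sup>2 = D ^ (p - 1)"
    using assms(2) by (auto simp: E_def mult.commute simp flip: power_mult elim!: oddE)
  then have "[E\<^sup>2 = 1] (mod int p)"
    using fermat_theorem_int[OF assms(1,3)] by simp
  then have "int p dvd (E - 1) * (E + 1)"
    by (simp add: cong_iff_dvd_diff power2_eq_square algebra_simps)
  then consider "[E = 1] (mod int p)" | "[E = -1] (mod int p)"
    using pi by (auto simp: cong_iff_dvd_diff prime_dvd_mult_iff)
  then show ?thesis
  proof cases
    case 1
    obtain m where m: "p = Suc m" using assms(1) by (metis not_prime_0 not0_implies_Suc)
    have "[quad_u u D p = 1] (mod int p)" using u 1 cong_trans by blast
    \<comment> \<open>The left side equals \<open>(u^2 - D) * quad_u u D m\<close>, which undoes the
      last step of the recursion.\<close>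
    then have "[u * quad_u u D p - quad_x u D p = u * 1 - u] (mod int p)"
      by (intro cong_diff cong_mult cong_refl x)
    then have "int p dvd (u\<^sup>2 - D) * quad_u u D m"
      unfolding m by (simp add: cong_0_iff algebra_simps power2_eq_square)
    then show ?thesis using assms(4) pi by (simp add: prime_dvd_mult_iff m)
  next
    case 2
    have "[quad_u u D p = -1] (mod int p)" using u 2 cong_trans by blast
    then have "[quad_x u D p + u * quad_u u D p = u + u * (-1)] (mod int p)"
      by (intro cong_add cong_mult cong_refl x)
    then show ?thesis by (simp add: cong_0_iff)
  qed
qed

text \<open>Modulo \<open>p\<close>, \<open>quad_u\<close> vanishes at \<open>q\<close> and at one
  of \<open>p - 1\<close> and \<open>p + 1\<close>, hence at the gcd of the two indices. As
  \<open>quad_u u D 1 = 1\<close>, that gcd is not 1 and must be \<open>q\<close>.\<close>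

lemma prime_dvd_quad_u_cong:
  fixes p q :: nat
  assumes p: "prime p" "odd p" "\<not> int p dvd D" "\<not> int p dvd u"
    and q: "prime q" and dvd: "int p dvd quad_u u D q"
  shows "[p = 1] (mod q) \<or> q dvd p + 1"
proof -
  have pi: "prime (int p)" using p by simp
  \<comment> \<open>Otherwise \<open>quad_u u D q\<close> would be a power of \<open>2 * u\<close>,
    which is prime to \<open>p\<close>.\<close>
  have norm: "\<not> int p dvd u\<^sup>2 - D"
  proof
    assume "int p dvd u\<^sup>2 - D"
    then have "[u\<^sup>2 = D] (mod int p)" by (simp add: cong_iff_dvd_diff)
    moreover obtain n where "q = Suc n" using q by (metis not_prime_0 not0_implies_Suc)
    ultimately have "[quad_u u D q = (2 * u) ^ n] (mod int p)"
      using quad_u_cong_of_dvd_norm by blast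
    then have "int p dvd (2 * u) ^ n" using dvd cong_dvd_iff cong_sym by (metis cong_dvd_iff)
    then have "int p dvd 2 * u" using pi prime_dvd_power by blast
    then have "int p dvd 2" using p pi by (simp add: prime_dvd_mult_iff)
    then have "p dvd 2" by (metis int_dvd_int_iff of_nat_numeral)
    then show False using p(1,2) by (metis dvd_refl prime_nat_iff two_is_prime_nat not_prime_1)
  qed
  \<comment> \<open>The two coordinates cannot both vanish, since the norm is invertible modulo
    \<open>p\<close>.\<close>
  have x: "\<not> int p dvd quad_x u D n" if "int p dvd quad_u u D n" for n
  proof
    assume "int p dvd quad_x u D n"
    then have "int p dvd (quad_x u D n)\<^sup>2 - D * (quad_u u D n)\<^sup>2"
      using that by (simp add: dvd_mult power2_eq_square)
    then have "int p dvd (u\<^sup>2 - D) ^ n" by (simp add: quad_norm)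
    then show False using norm pi prime_dvd_power by blast
  qed
  have mult: "int p dvd quad_u u D (m * k)" if "int p dvd quad_u u D m" for m k
    by (induction k) (use that in \<open>auto simp: quad_add\<close>)
  obtain m where m: "m = p - 1 \<or> m = p + 1" "int p dvd quad_u u D m"
    using quad_u_prime_dvd[OF p(1-3) norm] by blast
  have "m > 0" using m(1) prime_gt_1_nat[OF p(1)] by auto
  then obtain i k where ik: "m * i = q * k + gcd m q" using bezout_nat[of m q] by auto
  have "int p dvd quad_u u D (q * k + gcd m q)" using mult[OF m(2), of i] by (simp add: ik)
  then have "int p dvd quad_x u D (q * k) * quad_u u D (gcd m q)"
    using mult[OF dvd, of k] by (simp add: quad_add dvd_add_left_iff)
  then have "int p dvd quad_u u D (gcd m q)"
    using x[OF mult[OF dvd, of k]] pi by (simp add: prime_dvd_mult_iff)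
  moreover have "\<not> int p dvd quad_u u D 1" using pi by (auto dest: zdvd1_eq[THEN iffD1] simp: prime_int_iff)
  ultimately have "gcd m q \<noteq> 1" by metis
  then have "q dvd m" using q by (metis coprime_iff_gcd_eq_1 gcd.commute prime_imp_coprime)
  then show ?thesis
    using m(1) prime_gt_0_nat[OF p(1)] by (auto simp: cong_altdef_nat cong_sym)
qed

lemma cong_1_if_prime_factors_cong_1:
  fixes n q :: nat
  assumes "n > 0" "\<And>p. prime p \<Longrightarrow> p dvd n \<Longrightarrow> [p = 1] (mod q)"
  shows "[n = 1] (mod q)"
  using assms
proof (induction n rule: less_induct)
  case (less n)
  show ?case
  proof (cases "n = 1")
    case False
    then obtain p where p: "prime p" "p dvd n" using prime_factor_nat by blast
    then obtain m where m: "n = p * m" by blast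
    have "m > 0" "m < n" using less.prems(1) p m prime_gt_1_nat[of p] by auto
    then have "[m = 1] (mod q)" using less.IH[of m] less.prems(2) m by auto
    then have "[p * m = 1 * 1] (mod q)" using less.prems(2) p by (intro cong_mult) auto
    then show ?thesis by (simp add: m)
  qed simp
qed

text \<open>
  Take a quadratic nonresidue \<open>D > 0\<close> modulo \<open>q\<close>, and let \<open>u\<close> be the product of the primes up to
  \<open>max(q, D, M)\<close> that do not divide \<open>D\<close>. The Lucas number \<open>quad_u u D q\<close> is \<open>-1\<close> modulo \<open>q\<close>, while all
  its prime factors exceed \<open>M\<close> and are \<open>1\<close> or \<open>-1\<close> modulo \<open>q\<close>.
\<close>

lemma infinitely_many_primes_cong_minus_1:
  fixes q M :: nat
  assumes "prime q"
  obtains p where "prime p" "p > M" "q dvd p + 1"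
proof (cases "q = 2")
  case True
  obtain p where "prime p" "p > max M 2" using bigger_prime by blast
  then show ?thesis using that[of p] True prime_odd_nat[of p] by auto
next
  case False
  then have "q > 2" using prime_ge_2_nat[OF assms] by linarith
  then have q: "prime q" "odd q" using assms prime_odd_nat by auto
  \<comment> \<open>A primitive root modulo an odd prime is a quadratic nonresidue;
    \<open>Dh\<close> below derives this from its order.\<close>
  obtain D where D: "residue_primroot q D" using prime_primitive_root_exists[OF prime_gt_1_nat[OF assms] assms] by blast
  have "coprime q D" using D by (simp add: residue_primroot_def)
  then have qD: "\<not> q dvd D" using q(1) by (metis coprime_common_divisor dvd_refl not_prime_unit)
  then have "D > 0" by (cases "D = 0") auto
  define h where "h = q div 2"
  have h: "q = Suc (2 * h)" using q(2) by (auto simp: h_def elim!: oddE)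
  have Dh: "[int D ^ h = -1] (mod int q)"
  proof -
    have "\<not> q - 1 dvd h" using \<open>q > 2\<close> h by (auto dest: dvd_imp_le)
    then have "\<not> [D ^ h = 1] (mod q)"
      using D totient_prime[OF q(1)] unfolding residue_primroot_def ord_divides by simp
    moreover have "[(D ^ h)\<^sup>2 = 1] (mod q)"
      using fermat_theorem[OF q(1) qD] by (simp add: h power_mult[symmetric] mult.commute flip: power_mult)
    then have "[int ((D ^ h)\<^sup>2) = int 1] (mod int q)" by (simp only: cong_int_iff)
    then have "int q dvd (int D ^ h - 1) * (int D ^ h + 1)"
      by (simp add: cong_iff_dvd_diff power2_eq_square algebra_simps)
    moreover have "[int D ^ h = 1] (mod int q) \<longleftrightarrow> [D ^ h = 1] (mod q)"
      by (metis cong_int_iff of_nat_1 of_nat_power)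
    ultimately show ?thesis using q(1) by (auto simp: cong_iff_dvd_diff prime_dvd_mult_iff)
  qed
  define B where "B = Max {q, D, M}"
  define S where "S = {r. prime r \<and> r \<le> B \<and> \<not> r dvd D}"
  define u where "u = int (\<Prod>S)"
  have B: "q \<le> B" "D \<le> B" "M \<le> B" by (auto simp: B_def)
  have fin: "finite S" by (rule finite_subset[of _ "{..B}"]) (auto simp: S_def)
  have u_dvd: "int r dvd u \<longleftrightarrow> r \<in> S" if "prime r" for r
  proof
    assume "int r dvd u"
    then have "r dvd \<Prod>S" unfolding u_def int_dvd_int_iff .
    then have "\<exists>s\<in>S. r dvd s" using prime_dvd_prod_iff[OF fin that, of "\<lambda>x. x"] by simp
    then obtain s where "s \<in> S" "r dvd s" by blast
    then have "r = s" using that by (auto simp: S_def primes_dvd_imp_eq)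
    then show "r \<in> S" using \<open>s \<in> S\<close> by simp
  next
    assume "r \<in> S"
    then show "int r dvd u" unfolding u_def int_dvd_int_iff using fin dvd_prodI[of S r "\<lambda>x. x"] by simp
  qed
  have "u > 0" unfolding u_def using fin by (auto simp: S_def prime_gt_0_nat intro!: prod_pos)
  define n where "n = nat (quad_u u (int D) q)"
  have npos: "quad_u u (int D) q > 0"
    using quad_pos[OF \<open>u > 0\<close>, of "int D" "2 * h"] \<open>D > 0\<close> h by simp
  then have n: "int n = quad_u u (int D) q" "n > 0" by (auto simp: n_def)
  have cong_u: "[int n = int D ^ h] (mod u)"
    unfolding n h by (rule quad_u_odd_cong)
  \<comment> \<open>A prime up to \<open>B\<close> divides \<open>u\<close>, where \<open>n\<close>
    is \<open>D ^ h\<close>, or divides \<open>D\<close>, where \<open>n\<close> is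
    \<open>q * u ^ (2 * h)\<close>; neither vanishes modulo such a prime.\<close>
  have large: "r > B" if "prime r" "r dvd n" for r
  proof (rule ccontr)
    assume "\<not> r > B"
    then have rB: "r \<le> B" by simp
    have ri: "prime (int r)" "int r dvd int n" using that by auto
    show False
    proof (cases "r dvd D")
      case False
      then have "int r dvd u" using rB that by (auto simp: u_dvd S_def)
      then have "int r dvd int D ^ h" using cong_u ri(2) by (metis cong_dvd_modulus cong_dvd_iff)
      then have "int r dvd int D" using ri(1) prime_dvd_power by blast
      then show False using False by simp
    next
      case True
      have "[int n = int q * u ^ (2 * h)] (mod int D)"
        unfolding n h using quad_u_cong_mod_D by blast
      then have "int r dvd int q * u ^ (2 * h)"
        using True ri(2) by (metis cong_dvd_modulus cong_dvd_iff int_dvd_int_iff)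
      then have "int r dvd int q \<or> int r dvd u"
        using ri(1) by (metis prime_dvd_mult_iff prime_dvd_power)
      then have "r = q \<or> r \<in> S" using that q(1) by (auto simp: u_dvd primes_dvd_imp_eq)
      then show False using True qD by (auto simp: S_def)
    qed
  qed
  have "q \<in> S" using q qD B by (simp add: S_def)
  then have "int q dvd u" using u_dvd q(1) by blast
  then have nq: "[int n = -1] (mod int q)"
    using cong_u Dh by (meson cong_dvd_modulus cong_trans)
  have "\<not> [n = 1] (mod q)"
  proof
    assume "[n = 1] (mod q)"
    then have "[int n = 1] (mod int q)" by (metis cong_int_iff of_nat_1)
    then have "[-1 = 1] (mod int q)" using nq by (meson cong_sym cong_trans)
    then have "int q dvd 2" by (simp add: cong_iff_dvd_diff)
    then have "q dvd 2" by (metis int_dvd_int_iff of_nat_numeral)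
    then show False using \<open>q > 2\<close> by (auto dest: dvd_imp_le)
  qed
  then obtain p where p: "prime p" "p dvd n" "\<not> [p = 1] (mod q)"
    using cong_1_if_prime_factors_cong_1[OF n(2)] by blast
  have "p > B" using large p by blast
  then have "p > 2" "p > M" "p > D" using B \<open>q > 2\<close> by linarith+
  have "q dvd p + 1"
  proof -
    have "odd p" using prime_odd_nat[OF p(1)] \<open>p > 2\<close> by simp
    moreover have "\<not> int p dvd int D" using \<open>p > D\<close> \<open>D > 0\<close> by (auto dest: dvd_imp_le)
    moreover have "\<not> int p dvd u" using \<open>p > B\<close> p(1) by (auto simp: u_dvd S_def)
    moreover have "int p dvd quad_u u (int D) q" using p(2) unfolding n(1)[symmetric] by simp
    ultimately show ?thesis using prime_dvd_quad_u_cong[OF p(1) _ _ _ q(1)] p(3) by blast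
  qed
  then show ?thesis using that p(1) \<open>p > M\<close> by blast
qed

section \<open>Primes not dividing a term of the sequence\<close>

lemma a_seq_Suc:
  assumes "n \<ge> 1"
  shows "a_seq (Suc n) = a_seq n * (b_seq (Suc n) + 1)"
proof -
  obtain m where m: "n = Suc m" using assms by (cases n) auto
  have "lcm (Suc n) (a_seq n) = (Suc n div gcd (Suc n) (a_seq n)) * a_seq n"
    unfolding lcm_nat_def by (simp only: div_mult_swap gcd_dvd1 dvd_div_mult)
  then show ?thesis by (simp add: m b_seq_def algebra_simps)
qed

lemma a_seq_dvd:
  assumes "1 \<le> m" "m \<le> n"
  shows "a_seq m dvd a_seq n"
  using assms(2)
proof (induction n rule: dec_induct)
  case (step n)
  then show ?case using a_seq_Suc[of n] assms(1) by (simp add: dvd_mult2 del: mult_Suc_right)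
qed simp

text \<open>Coprimality gives \<open>b_seq n = n\<close>, so the multiplier in
  \<open>a_seq_Suc\<close> is \<open>n + 1\<close>.\<close>

lemma Suc_dvd_a_seq:
  assumes "n \<ge> 2" "coprime n (a_seq (n - 1))"
  shows "n + 1 dvd a_seq n"
proof -
  have "a_seq n = a_seq (n - 1) * (n + 1)"
    using assms a_seq_Suc[of "n - 1"] by (simp add: b_seq_def)
  then show ?thesis by (metis dvd_triv_right)
qed

lemma even_a_seq:
  assumes "n \<ge> 3"
  shows "even (a_seq n)"
proof -
  have "a_seq 3 = 6" by (simp add: numeral_eq_Suc lcm_nat_def)
  then show ?thesis using a_seq_dvd[of 3 n] assms by (auto intro: dvd_trans[of 2 6])
qed

text \<open>A new factor \<open>r\<close> would have to divide \<open>b_seq (Suc k) + 1\<close>,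
  which is at most \<open>k + 2\<close>, and this forces \<open>r = k + 2\<close>. But then
  \<open>Suc k\<close> and \<open>a_seq k\<close> are both even, so \<open>b_seq (Suc k)\<close> is
  at most half of \<open>Suc k\<close>.\<close>

lemma prime_not_dvd_a_seq:
  assumes "prime r" "r > 3" "1 \<le> k" "k < r"
  shows "\<not> r dvd a_seq k"
  using assms(3,4)
proof (induction k rule: dec_induct)
  case base
  then show ?case using assms by simp
next
  case (step k)
  have "\<not> r dvd b_seq (Suc k) + 1"
  proof
    assume "r dvd b_seq (Suc k) + 1"
    then have ge: "b_seq (Suc k) + 1 \<ge> r" by (simp add: dvd_imp_le)
    have le: "b_seq (Suc k) \<le> Suc k" by (simp add: b_seq_def)
    then have k: "r = Suc (Suc k)" "b_seq (Suc k) = Suc k" using ge step.prems by linarith+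
    \<comment> \<open>The value \<open>k = 2\<close> would make \<open>r = 4\<close>, not a
      prime.\<close>
    then have "k \<ge> 3" "even (Suc k)"
      using assms(2) prime_odd_nat[OF assms(1)] by (cases "k = 2"; auto)+
    then have "2 dvd gcd (Suc k) (a_seq k)" using even_a_seq[of k] by simp
    then have "gcd (Suc k) (a_seq k) \<ge> 2" by (auto intro!: dvd_imp_le)
    then have "b_seq (Suc k) \<le> Suc k div 2" by (simp add: b_seq_def div_le_mono2)
    then show False using k by simp
  qed
  then show ?case
    using step assms(1) unfolding a_seq_Suc[OF step.hyps(1)] by (simp only: prime_dvd_mult_iff) simp
qed

lemma a_seq_prime:
  assumes "prime r" "r > 3"
  shows "a_seq r = a_seq (r - 1) * (r + 1)"
proof -
  have "coprime r (a_seq (r - 1))"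
    using prime_not_dvd_a_seq[OF assms, of "r - 1"] assms by (intro prime_imp_coprime) auto
  then show ?thesis using a_seq_Suc[of "r - 1"] assms by (simp add: b_seq_def)
qed

text \<open>Any prime \<open>p\<close> beyond \<open>N\<close> with \<open>q dvd p + 1\<close>
  multiplies the sequence by \<open>p + 1\<close> and so supplies a further factor
  \<open>q\<close>.\<close>

lemma prime_power_dvd_a_seq:
  assumes "prime q"
  shows "\<exists>N\<ge>1. q ^ K dvd a_seq N"
proof (induction K)
  case (Suc K)
  then obtain N where N: "N \<ge> 1" "q ^ K dvd a_seq N" by blast
  obtain p where p: "prime p" "p > max N 3" "q dvd p + 1"
    using infinitely_many_primes_cong_minus_1[OF assms] by blast
  have "a_seq N dvd a_seq (p - 1)" using N p by (intro a_seq_dvd) auto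
  then have "q ^ K * q dvd a_seq (p - 1) * (p + 1)" using N p by (intro mult_dvd_mono) auto
  then show ?case using a_seq_prime[of p] p by (intro exI[of _ p]) (auto simp: mult.commute)
qed auto

text \<open>The number \<open>k + 1\<close> divides \<open>a_seq k\<close> and hence
  \<open>a_seq X\<close>. Applied to products \<open>k\<close> of primes missing from
  \<open>a_seq X\<close>, this is the sieve condition.\<close>

lemma not_dvd_Suc_of_coprime_a_seq:
  assumes "k \<ge> 2" "k \<le> X" "coprime k (a_seq X)" "\<not> q dvd a_seq X"
  shows "\<not> q dvd k + 1"
proof
  assume q: "q dvd k + 1"
  have "coprime k (a_seq (k - 1))"
    using assms a_seq_dvd[of "k - 1" X] by (intro coprime_divisors[OF dvd_refl _ assms(3)]) auto
  then have "k + 1 dvd a_seq k" using assms(1) by (rule Suc_dvd_a_seq[rotated])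
  also have "\<dots> dvd a_seq X" using assms by (intro a_seq_dvd) auto
  finally show False using q assms(4) dvd_trans by blast
qed

text \<open>For \<^term>\<open>p \<in> P\<close> the set \<^term>\<open>A\<close> avoids the residues \<open>-1/q\<close> modulo \<^term>\<open>p\<close>, for
  \<^term>\<open>q \<in> P - {p}\<close>, and these are pairwise distinct because \<^term>\<open>P\<close> lies in a dyadic block.\<close>

lemma card_mult_card_pow3_le:
  fixes P A :: "nat set" and y z k t :: nat
  assumes P: "\<And>p. p \<in> P \<Longrightarrow> prime p \<and> y < p \<and> p \<le> 2 * y" and A: "A \<subseteq> {..<z}"
    and no: "\<And>a p q. a \<in> A \<Longrightarrow> p \<in> P \<Longrightarrow> q \<in> P \<Longrightarrow> \<not> p dvd a * q + 1"
    and t: "card P \<le> t ^ k" and two: "card P \<ge> 2"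
  shows "real (card A) * real (card P) ^ 3 \<le> 32 * real y ^ 2 * (4 * real k * real t * real y ^ 2 + real z)"
proof -
  define H where "H = (\<lambda>p::nat. {h\<in>{0..<int p}. \<exists>q\<in>P. int p dvd h * int q + 1})"
  define W where "W = (\<Sum>p\<in>P. real (card (H p)) / real p)"
  have fin: "finite P" by (rule finite_subset[of _ "{..2*y}"]) (use P in auto)
  obtain p0 where "p0 \<in> P" using two by fastforce
  then have y: "y > 0" using P[of p0] by auto
  have "t > 0" using t two by (cases "t = 0") (auto simp: power_0_left split: if_splits)
  \<comment> \<open>The index \<open>q = p\<close> yields no residue, hence the loss of one.\<close>
  have cardH: "card P - 1 \<le> card (H p)" if p: "p \<in> P" for p
  proof -
    have pr: "prime (int p)" using P[OF p] by simp
    have "\<exists>h\<in>{0..<int p}. int p dvd h * int q + 1" if q: "q \<in> P - {p}" for q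
    proof -
      have "coprime (int q) (int p)"
        using q P[of q] P[OF p] by (auto intro: primes_coprime)
      then obtain x where x: "[int q * x = 1] (mod int p)" using cong_solve_coprime_int by blast
      have "[((- x) mod int p) * int q + 1 = (- x) * int q + 1] (mod int p)"
        by (intro cong_add cong_mult cong_refl cong_mod_leftI)
      also have "(- x) * int q + 1 = - (int q * x) + 1" by simp
      also have "[- (int q * x) + 1 = - 1 + 1] (mod int p)"
        using x by (intro cong_add cong_refl) (simp add: cong_minus_minus_iff)
      finally have "int p dvd ((- x) mod int p) * int q + 1" by (simp add: cong_0_iff)
      moreover have "(- x) mod int p \<in> {0..<int p}" using P[OF p] by auto
      ultimately show ?thesis by blast
    qed
    then obtain h where h: "\<And>q. q \<in> P - {p} \<Longrightarrow> h q \<in> {0..<int p} \<and> int p dvd h q * int q + 1"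
      by metis
    have "inj_on h (P - {p})"
    proof (rule inj_onI)
      fix q r assume qr: "q \<in> P - {p}" "r \<in> P - {p}" "h q = h r"
      have "int p dvd (h q * int q + 1) - (h q * int r + 1)"
        using h[OF qr(1)] h[OF qr(2)] qr(3) by (intro dvd_diff) auto
      then have "int p dvd h q * (int q - int r)" by (simp add: algebra_simps)
      moreover have "\<not> int p dvd h q"
      proof
        assume "int p dvd h q"
        then have "int p dvd 1" using h[OF qr(1)] by (metis dvd_add_right_iff dvd_mult2)
        then show False using pr by (simp add: prime_int_iff)
      qed
      ultimately have "int p dvd int q - int r" using pr by (simp add: prime_dvd_mult_iff)
      moreover have "\<bar>int q - int r\<bar> < int p" using P[of q] P[of r] P[OF p] qr by auto
      ultimately show "q = r" using zdvd_imp_le[of "int p" "\<bar>int q - int r\<bar>"] by fastforce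
    qed
    then have "card (P - {p}) = card (h ` (P - {p}))" by (simp add: card_image)
    also have "\<dots> \<le> card (H p)"
    proof (rule card_mono)
      show "finite (H p)" by (rule finite_subset[of _ "{0..<int p}"]) (auto simp: H_def)
    qed (use h in \<open>auto simp: H_def\<close>)
    finally show ?thesis using p fin by simp
  qed
  \<comment> \<open>Since \<open>card P\<close> is at least 2, each residue set has at least
    \<open>card P / 2\<close> elements, and each \<open>p\<close> is at most
    \<open>2 * y\<close>.\<close>
  have "real (card P) * (real (card P) / 2 / (2 * real y)) = (\<Sum>p\<in>P. real (card P) / 2 / (2 * real y))" by simp
  also have "\<dots> \<le> W" unfolding W_def
  proof (intro sum_mono frac_le)
    fix p assume p: "p \<in> P"
    have "real (card P) - 1 \<le> real (card (H p))" using cardH[OF p] by linarith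
    then show "real (card P) / 2 \<le> real (card (H p))" using two by linarith
    show "real p \<le> 2 * real y" "0 < real p" using P[OF p] by (auto simp: prime_gt_0_nat simp flip: of_nat_mult)
  qed auto
  finally have W: "(real (card P))\<^sup>2 / (4 * real y) \<le> W" by (simp add: power2_eq_square)
  have "real (card (int ` A)) * W\<^sup>2 \<le> real (k * (2 * y)\<^sup>2 * t + z) * (2 * real (card P))"
    unfolding W_def
  proof (rule linear_large_sieve[OF fin])
    show "int ` A \<subseteq> {0..<int z}" using A by auto
    show "a mod int p \<notin> H p" if a: "a \<in> int ` A" "p \<in> P" for a p
    proof
      assume "a mod int p \<in> H p"
      then obtain q where q: "q \<in> P" "int p dvd a mod int p * int q + 1" by (auto simp: H_def)
      obtain b where b: "a = int b" "b \<in> A" using a by auto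
      have "[a mod int p * int q + 1 = a * int q + 1] (mod int p)"
        by (intro cong_add cong_mult cong_refl) simp
      then have "int p dvd a * int q + 1" using q(2) cong_dvd_iff cong_sym by (metis cong_0_iff cong_trans)
      then have "int p dvd int (b * q + 1)" by (simp add: b add.commute)
      then have "p dvd b * q + 1" unfolding int_dvd_int_iff .
      then show False using no b a q by blast
    qed
    show "coprime p p' \<and> p * p' \<le> (2 * y)\<^sup>2" if "p \<in> P" "p' \<in> P" "p \<noteq> p'" for p p'
      using that P[of p] P[of p'] mult_mono[of p "2 * y" p' "2 * y"]
      by (auto intro: primes_coprime simp: power2_eq_square)
  qed (use P t y \<open>t > 0\<close> in \<open>auto simp: H_def prime_gt_0_nat\<close>)
  also have "real (card (int ` A)) = real (card A)" by (simp add: card_image)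
  finally have "real (card A) * W\<^sup>2 \<le> real (k * (2 * y)\<^sup>2 * t + z) * (2 * real (card P))" .
  moreover have "real (card A) * ((real (card P))\<^sup>2 / (4 * real y))\<^sup>2 \<le> real (card A) * W\<^sup>2"
    by (intro mult_left_mono power_mono W) auto
  ultimately have "real (card A) * ((real (card P))\<^sup>2 / (4 * real y))\<^sup>2 \<le> real (k * (2 * y)\<^sup>2 * t + z) * (2 * real (card P))"
    by linarith
  then have "real (card P) * (real (card A) * real (card P) ^ 3)
     \<le> real (card P) * (32 * real y ^ 2 * (4 * real k * real t * real y ^ 2 + real z))"
    using y by (simp add: field_simps power2_eq_square power3_eq_cube)
  then show ?thesis using two by simp
qed

section \<open>Chebyshev's bound and dyadic blocks\<close>

lemma prod_primes_dvd:
  fixes n :: nat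
  assumes "finite S" "\<And>p. p \<in> S \<Longrightarrow> prime p \<and> p dvd n"
  shows "\<Prod>S dvd n"
  using assms
proof (induction S rule: finite_induct)
  case (insert p S)
  have "coprime p (\<Prod>S)"
    using insert by (intro prod_coprime_right) (auto intro!: primes_coprime)
  then show ?case using insert by (auto intro!: divides_mult)
qed simp

text \<open>All primes between \<open>y\<close> and \<open>2 * y\<close> divide the central binomial
  coefficient, which is at most \<open>4 ^ y\<close>, while each of them exceeds
  \<open>y\<close>.\<close>

lemma card_primes_dyadic_le:
  "real (card {p::nat. prime p \<and> 2 ^ j < p \<and> p \<le> 2 * 2 ^ j}) * real j \<le> 2 * 2 ^ j"
proof -
  define y :: nat where "y = 2 ^ j"
  define S where "S = {p. prime p \<and> y < p \<and> p \<le> 2 * y}"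
  have fin: "finite S" by (rule finite_subset[of _ "{..2*y}"]) (auto simp: S_def)
  have "\<Prod>S dvd (2 * y) choose y"
  proof (rule prod_primes_dvd[OF fin])
    fix p assume "p \<in> S"
    then have p: "prime p" "y < p" "p \<le> 2 * y" by (auto simp: S_def)
    have "fact y * fact y * ((2 * y) choose y) = fact (2 * y)"
      using binomial_fact_lemma[of y "2 * y"] by (simp add: mult_2)
    moreover have "p dvd fact (2 * y)" "\<not> p dvd fact y"
      using p by (simp_all add: prime_dvd_fact_iff)
    ultimately have "p dvd (2 * y) choose y" using p(1) by (metis prime_dvd_mult_iff)
    then show "prime p \<and> p dvd (2 * y) choose y" using p by simp
  qed
  then have "\<Prod>S \<le> (2 * y) choose y" by (rule dvd_imp_le) simp
  also have "\<dots> \<le> 2 ^ (2 * y)" by (rule binomial_le_pow2)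
  finally have "\<Prod>S \<le> 2 ^ (2 * y)" .
  moreover have "y ^ card S \<le> \<Prod>S"
    using prod_mono[of S "\<lambda>_. y" "\<lambda>x. x"] by (auto simp: S_def)
  ultimately have "(2::nat) ^ (j * card S) \<le> 2 ^ (2 * y)"
    by (simp add: y_def power_mult)
  then have "j * card S \<le> 2 * y" by (rule power_le_imp_le_exp[rotated]) simp
  then have "real (j * card S) \<le> real (2 * y)" by (rule of_nat_mono)
  then show ?thesis by (simp add: S_def y_def mult.commute)
qed

text \<open>The part of the set \<open>U\<close> from the introduction in the dyadic block of
  \<open>2 ^ j\<close>.\<close>

definition unhit_block :: "nat \<Rightarrow> nat \<Rightarrow> nat set" where
  "unhit_block X j = {q. prime q \<and> 2 ^ j < q \<and> q \<le> 2 * 2 ^ j \<and> \<not> q dvd a_seq X}"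

lemma unhit_block_subset: "unhit_block X j \<subseteq> {p. prime p \<and> 2 ^ j < p \<and> p \<le> 2 * 2 ^ j}"
  by (auto simp: unhit_block_def)

lemma finite_primes_dyadic: "finite {p::nat. prime p \<and> 2 ^ j < p \<and> p \<le> 2 * 2 ^ j}"
  by (rule finite_subset[of _ "{..2*2^j}"]) auto

lemma finite_unhit_block [simp]: "finite (unhit_block X j)"
  by (rule finite_subset[OF unhit_block_subset finite_primes_dyadic])

lemma card_unhit_block_le: "real (card (unhit_block X j)) * real j \<le> 2 * 2 ^ j"
proof -
  have "real (card (unhit_block X j)) * real j \<le> real (card {p::nat. prime p \<and> 2 ^ j < p \<and> p \<le> 2 * 2 ^ j}) * real j"
    by (intro mult_right_mono of_nat_mono card_mono finite_primes_dyadic unhit_block_subset) auto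
  then show ?thesis using card_primes_dyadic_le[of j] by linarith
qed

lemma card_unhit_block_le_pow: "card (unhit_block X j) \<le> 2 ^ j"
proof -
  have "card (unhit_block X j) \<le> card {2 ^ j<..2 * 2 ^ j :: nat}"
    by (rule card_mono) (auto simp: unhit_block_def)
  then show ?thesis by simp
qed

text \<open>These are the rich blocks. With this threshold every other block has density at most
  \<open>1 / j ^ 2\<close>, the term of a convergent series.\<close>

definition bad_block :: "nat \<Rightarrow> nat \<Rightarrow> bool" where
  "bad_block X j \<longleftrightarrow> real (card (unhit_block X j)) * (real j)\<^sup>2 > 2 ^ j"

lemma unhit_coprime: "q \<in> unhit_block X j \<Longrightarrow> coprime q (a_seq X)"
  by (auto simp: unhit_block_def intro: prime_imp_coprime)

text \<open>The sieve is used with \<open>t\<close> at most twice the \<open>k\<close>-th root of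
  \<open>2 ^ j\<close>, so it loses only \<open>2 powr (j / k)\<close> up to a constant. The range
  of \<open>A\<close> leaves room for products of two primes of the block.\<close>

lemma card_mult_unhit_block_le:
  assumes "A \<subseteq> {..<5 * (2 ^ j)\<^sup>2}" "k > 0" and two: "card (unhit_block X j) \<ge> 2"
    and A: "\<And>a q. a \<in> A \<Longrightarrow> q \<in> unhit_block X j \<Longrightarrow> a > 0 \<and> coprime a (a_seq X) \<and> a * q \<le> X"
  shows "real (card A) * real (card (unhit_block X j)) ^ 3
    \<le> 64 * (4 * real k + 5) * 2 ^ (4 * j) * 2 powr (real j / real k)"
proof -
  define t :: nat where "t = 2 ^ (j div k + 1)"
  have "j \<le> k * (j div k + 1)"
    using \<open>k > 0\<close> by (metis Suc_eq_plus1 dividend_less_times_div less_imp_le mult_Suc_right add.commute)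
  then have "(2::nat) ^ j \<le> 2 ^ (k * (j div k + 1))" by (intro power_increasing) auto
  also have "\<dots> = t ^ k" unfolding t_def by (metis power_mult mult.commute)
  finally have "(2::nat) ^ j \<le> t ^ k" .
  then have t: "card (unhit_block X j) \<le> t ^ k" using card_unhit_block_le_pow order_trans by blast
  have "real (j div k) \<le> real j / real k" using of_nat_div_le_of_nat[of j k] by simp
  then have "2 powr real (j div k) \<le> 2 powr (real j / real k)" by (intro powr_mono) auto
  then have tle: "real t \<le> 2 * 2 powr (real j / real k)" by (simp add: t_def powr_realpow)
  have "t > 0" by (simp add: t_def)
  then have "real t \<ge> 1" by linarith
  have "real (card A) * real (card (unhit_block X j)) ^ 3
     \<le> 32 * real (2 ^ j) ^ 2 * (4 * real k * real t * real (2 ^ j) ^ 2 + real (5 * (2 ^ j)\<^sup>2))"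
  proof (rule card_mult_card_pow3_le[OF _ assms(1) _ t two])
    fix a p q assume *: "a \<in> A" "p \<in> unhit_block X j" "q \<in> unhit_block X j"
    have q: "q \<ge> 2" using *(3) by (auto simp: unhit_block_def prime_ge_2_nat)
    have "a * q \<ge> 1 * 2" using A[OF *(1,3)] q by (intro mult_mono) auto
    then show "\<not> p dvd a * q + 1"
      using A[OF *(1,3)] * unhit_coprime[OF *(3)]
      by (intro not_dvd_Suc_of_coprime_a_seq[where X = X]) (auto simp: unhit_block_def)
  qed (auto simp: unhit_block_def)
  also have "\<dots> = 32 * 2 ^ (4 * j) * (4 * real k * real t + 5)"
  proof -
    have "(2::real) ^ (4 * j) = (2 ^ j) ^ 4" by (simp add: mult.commute flip: power_mult)
    then show ?thesis by (simp add: power2_eq_square power4_eq_xxxx algebra_simps)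
  qed
  also have "\<dots> \<le> 32 * 2 ^ (4 * j) * ((4 * real k + 5) * real t)"
    using \<open>real t \<ge> 1\<close> by (intro mult_left_mono) (auto simp: algebra_simps)
  also have "\<dots> \<le> 32 * 2 ^ (4 * j) * ((4 * real k + 5) * (2 * 2 powr (real j / real k)))"
    by (intro mult_left_mono tle) auto
  finally show ?thesis by (simp add: algebra_simps)
qed

text \<open>By unique factorization a pair is recovered as the set of elements of \<open>P\<close>
  dividing its product.\<close>

lemma card_pair_products:
  fixes P :: "nat set"
  assumes "finite P" "\<And>p. p \<in> P \<Longrightarrow> prime p"
  shows "card (Prod ` {B. B \<subseteq> P \<and> card B = 2}) = card P choose 2"
proof -
  have mem: "p dvd \<Prod>B \<longleftrightarrow> p \<in> B" if "B \<subseteq> P" "p \<in> P" for B p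
  proof -
    have fin: "finite B" using that(1) assms(1) finite_subset by blast
    have "p dvd \<Prod>B \<longleftrightarrow> (\<exists>q\<in>B. p dvd q)"
      using prime_dvd_prod_iff[OF fin assms(2)[OF that(2)], of "\<lambda>x. x"] by simp
    also have "\<dots> \<longleftrightarrow> p \<in> B"
    proof
      assume "\<exists>q\<in>B. p dvd q"
      then obtain q where q: "q \<in> B" "p dvd q" by blast
      then have "p = q" using that assms(2)[of p] assms(2)[of q] by (intro primes_dvd_imp_eq) auto
      then show "p \<in> B" using q by simp
    next
      assume "p \<in> B"
      then show "\<exists>q\<in>B. p dvd q" by (intro bexI[of _ p] dvd_refl)
    qed
    finally show ?thesis .
  qed
  have "inj_on Prod {B. B \<subseteq> P \<and> card B = 2}"
  proof (rule inj_onI)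
    fix B C assume "B \<in> {B. B \<subseteq> P \<and> card B = 2}" "C \<in> {B. B \<subseteq> P \<and> card B = 2}" "\<Prod>B = \<Prod>C"
    then have BC: "B \<subseteq> P" "C \<subseteq> P" and eq: "\<Prod>B = \<Prod>C" by simp_all
    have "p \<in> B \<longleftrightarrow> p \<in> C" if "p \<in> P" for p
      using mem[OF BC(1) that] mem[OF BC(2) that] eq by simp
    then show "B = C" using BC by blast
  qed
  then show ?thesis using n_subsets[OF assms(1), of 2] by (simp add: card_image)
qed

lemma bad_block_card:
  assumes "bad_block X j" "j > 0"
  shows "real (card (unhit_block X j)) > 2 ^ j / (real j)\<^sup>2"
  using assms by (simp add: bad_block_def field_simps)

text \<open>With \<open>n\<close> the size of the block at \<open>j\<close>, the sieve bounds
  \<open>card A * n ^ 3\<close> by a constant times \<open>2 powr (4 * j + j / k)\<close>. For the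
  first claim \<open>A\<close> consists of products of two primes of this block, for the second it
  is the block at \<open>j'\<close>; powers of \<open>j\<close> are absorbed by taking
  \<open>j\<close> large.\<close>

lemma bad_blocks_close:
  assumes "k \<ge> 2"
  shows "\<exists>J\<ge>1. \<forall>X j. j \<ge> J \<longrightarrow> bad_block X j \<longrightarrow>
    X < 2 ^ (3 * j + 3) \<and>
    (\<forall>j'. j \<le> j' \<longrightarrow> j' \<le> 2 * j \<longrightarrow> 2 ^ (j + j' + 2) \<le> X \<longrightarrow> bad_block X j'
       \<longrightarrow> real j' \<le> real j + 2 * real j / real k)"
proof -
  define C where "C = 256 * (4 * real k + 5)"
  define c where "c = 1 / real k"
  have C: "C > 0" and c: "c > 0" "c \<le> 1/2" using assms by (auto simp: C_def c_def field_simps)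
  \<comment> \<open>The exponent 10 comes from \<open>n ^ 5\<close> with
    \<open>n > 2 ^ j / j ^ 2\<close>, the exponent 8 in \<open>e2\<close> from three such factors
    and one for the block at \<open>j'\<close>; \<open>e3\<close> ensures
    \<open>n > 2\<close>.\<close>
  have e1: "eventually (\<lambda>j::nat. C * real j ^ 10 * 2 powr (real j / 2) < 2 powr real j) at_top"
    using C by real_asymp
  have e2: "eventually (\<lambda>j::nat. C * real j ^ 8 < 2 powr (c * real j)) at_top"
    using C c by real_asymp
  have e3: "eventually (\<lambda>j::nat. 2 * real j ^ 2 < 2 powr (real j)) at_top"
    by real_asymp
  obtain J where J: "\<And>j. j \<ge> J \<Longrightarrow> C * real j ^ 10 * 2 powr (real j / 2) < 2 powr real j \<and>
      C * real j ^ 8 < 2 powr (c * real j) \<and> 2 * real j ^ 2 < 2 powr (real j)"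
    using eventually_conj[OF e1 eventually_conj[OF e2 e3]] by (auto simp: eventually_at_top_linorder)
  show ?thesis
  proof (intro exI[of _ "max J 1"] conjI allI impI)
    fix X j assume j: "max J 1 \<le> j" "bad_block X j"
    define U where "U = unhit_block X j"
    define n where "n = real (card U)"
    have j1: "j \<ge> 1" "real j > 0" using j by auto
    have jJ: "C * real j ^ 10 * 2 powr (real j / 2) < 2 ^ j"
      "C * real j ^ 8 < 2 powr (c * real j)" "2 * real j ^ 2 < 2 ^ j"
      using J[of j] j by (auto simp: powr_realpow)
    have n: "n > 2 ^ j / (real j)\<^sup>2" using bad_block_card[OF j(2)] j1 by (simp add: n_def U_def)
    have n0: "2 ^ j / (real j)\<^sup>2 > 0" using j1 by simp
    have "2 ^ j / (real j)\<^sup>2 > 2" using jJ(3) j1 by (simp add: field_simps)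
    then have "n > 2" using n by linarith
    then have two: "card U \<ge> 2" by (simp add: n_def)
    have powrc: "2 powr (real j / real k) = 2 powr (c * real j)" by (simp add: c_def)
    have boundC: "64 * (4 * real k + 5) * 2 ^ (4 * j) * 2 powr (real j / real k) = C / 4 * 2 ^ (4 * j) * 2 powr (c * real j)"
      by (simp add: C_def powrc)
    show "X < 2 ^ (3 * j + 3)"
    proof (rule ccontr)
      assume "\<not> X < 2 ^ (3 * j + 3)"
      then have X: "2 ^ (3 * j + 3) \<le> X" by simp
      define A where "A = Prod ` {B. B \<subseteq> U \<and> card B = 2}"
      have elem: "\<exists>p\<in>U. \<exists>q\<in>U. a = p * q" if aA: "a \<in> A" for a
      proof -
        obtain B where "a = \<Prod>B" "B \<in> {B. B \<subseteq> U \<and> card B = 2}"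
          using aA unfolding A_def by auto
        then have B: "B \<subseteq> U" "card B = 2" "a = \<Prod>B" by simp_all
        obtain p q where "B = {p, q}" "p \<noteq> q" using B(2) by (meson card_2_iff)
        then have "p \<in> U" "q \<in> U" "a = p * q" using B by auto
        then show ?thesis by blast
      qed
      have Ule: "p \<le> 2 * 2 ^ j" "p > 0" if "p \<in> U" for p using that by (auto simp: U_def unhit_block_def)
      have cardA: "real (card A) \<ge> n\<^sup>2 / 4"
      proof -
        have "card A = card U choose 2"
          unfolding A_def by (rule card_pair_products) (auto simp: U_def unhit_block_def)
        also have "\<dots> = card U * (card U - 1) div 2" by (rule choose_two)
        finally have "card A = card U * (card U - 1) div 2" .
        moreover have "even (card U * (card U - 1))" by auto
        ultimately have "2 * card A = card U * (card U - 1)" by simp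
        then have "real (2 * card A) = real (card U * (card U - 1))" by (rule arg_cong)
        then have "2 * real (card A) = n * (n - 1)" using two by (simp add: n_def of_nat_diff)
        moreover have "n * (n - 1) \<ge> n * (n / 2)" using \<open>n > 2\<close> by (intro mult_left_mono) auto
        ultimately show ?thesis by (simp add: power2_eq_square)
      qed
      have "real (card A) * n ^ 3 \<le> C / 4 * 2 ^ (4 * j) * 2 powr (c * real j)"
        unfolding n_def U_def boundC[symmetric]
      proof (rule card_mult_unhit_block_le)
        show "A \<subseteq> {..<5 * (2 ^ j)\<^sup>2}"
        proof
          fix a assume "a \<in> A"
          then obtain p q where pq: "p \<in> U" "q \<in> U" "a = p * q" using elem by blast
          have "p * q \<le> (2 * 2 ^ j) * (2 * 2 ^ j)" using Ule pq by (intro mult_mono) auto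
          also have "\<dots> < 5 * (2 ^ j)\<^sup>2" by (simp add: power2_eq_square)
          finally show "a \<in> {..<5 * (2 ^ j)\<^sup>2}" using pq by simp
        qed
        fix a r assume "a \<in> A" "r \<in> unhit_block X j"
        then obtain p q where pq: "p \<in> U" "q \<in> U" "a = p * q" and r: "r \<in> U" using elem U_def by blast
        have "p * q * r \<le> (2 * 2 ^ j) * (2 * 2 ^ j) * (2 * 2 ^ j)" using Ule pq r by (intro mult_mono) auto
        also have "\<dots> = 2 ^ (3 * j + 3)" by (simp add: power_add mult.commute power_mult power3_eq_cube)
        finally show "a > 0 \<and> coprime a (a_seq X) \<and> a * r \<le> X"
          using X pq Ule[of p] Ule[of q] unhit_coprime[of _ X j] by (auto simp: U_def)
      qed (use two assms in \<open>auto simp: U_def\<close>)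
      moreover have "n\<^sup>2 / 4 * n ^ 3 \<le> real (card A) * n ^ 3"
        using cardA \<open>n > 2\<close> by (intro mult_right_mono) auto
      ultimately have "n ^ 5 \<le> C * 2 ^ (4 * j) * 2 powr (c * real j)"
        by (simp add: power2_eq_square numeral_eq_Suc)
      moreover have "(2 ^ j / (real j)\<^sup>2) ^ 5 < n ^ 5" using n n0 by (intro power_strict_mono) auto
      moreover have "2 powr (c * real j) \<le> 2 powr (real j / 2)"
        using c(2) j1 by (intro powr_mono) auto
      then have "C * 2 ^ (4 * j) * 2 powr (c * real j) \<le> C * 2 ^ (4 * j) * 2 powr (real j / 2)"
        using C by (intro mult_left_mono) auto
      ultimately have "(2 ^ j / (real j)\<^sup>2) ^ 5 < C * 2 ^ (4 * j) * 2 powr (real j / 2)" by linarith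
      then have "2 ^ (4 * j) * 2 ^ j < 2 ^ (4 * j) * (C * real j ^ 10 * 2 powr (real j / 2))"
        using j1 by (simp add: power_divide divide_less_eq flip: power_mult power_add) (simp add: mult_ac)
      then show False using jJ(1) by simp
    qed
    fix j' assume j': "j \<le> j'" "j' \<le> 2 * j" "2 ^ (j + j' + 2) \<le> X" "bad_block X j'"
    \<comment> \<open>The bound of \<open>j'\<close> by \<open>2 * j\<close> keeps this block in the
      admissible range and lets \<open>2 * j\<close> replace \<open>j'\<close> in the lower bound
      for its size.\<close>
    define A where "A = unhit_block X j'"
    have "real (card A) * n ^ 3 \<le> C / 4 * 2 ^ (4 * j) * 2 powr (c * real j)"
      unfolding n_def U_def boundC[symmetric]
    proof (rule card_mult_unhit_block_le)
      show "A \<subseteq> {..<5 * (2 ^ j)\<^sup>2}"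
      proof
        fix a assume "a \<in> A"
        then have "a \<le> 2 * 2 ^ j'" by (auto simp: A_def unhit_block_def)
        also have "\<dots> \<le> 2 * 2 ^ (2 * j)" using j' by (intro mult_left_mono power_increasing) auto
        also have "\<dots> < 5 * (2 ^ j)\<^sup>2" by (simp add: power2_eq_square mult_2 power_add)
        finally show "a \<in> {..<5 * (2 ^ j)\<^sup>2}" by simp
      qed
      fix a r assume a: "a \<in> A" and r: "r \<in> unhit_block X j"
      have "a * r \<le> (2 * 2 ^ j') * (2 * 2 ^ j)"
        using a r by (intro mult_mono) (auto simp: A_def unhit_block_def)
      also have "\<dots> = 2 ^ (j + j' + 2)" by (simp add: power_add)
      finally show "a > 0 \<and> coprime a (a_seq X) \<and> a * r \<le> X"
        using j'(3) a unhit_coprime[of a X j'] by (auto simp: A_def unhit_block_def prime_gt_0_nat)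
    qed (use two assms in \<open>auto simp: U_def\<close>)
    moreover have "2 ^ j' / (2 * real j)\<^sup>2 * (2 ^ j / (real j)\<^sup>2) ^ 3 \<le> real (card A) * n ^ 3"
    proof (intro mult_mono power_mono)
      have "2 ^ j' / (2 * real j)\<^sup>2 \<le> 2 ^ j' / (real j')\<^sup>2"
        using j' j1 by (intro divide_left_mono power_mono) auto
      also have "\<dots> < real (card A)" using bad_block_card[OF j'(4)] j' j1 by (simp add: A_def)
      finally show "2 ^ j' / (2 * real j)\<^sup>2 \<le> real (card A)" by simp
    qed (use n n0 in auto)
    ultimately have "2 ^ j' / (2 * real j)\<^sup>2 * (2 ^ j / (real j)\<^sup>2) ^ 3 \<le> C / 4 * 2 ^ (4 * j) * 2 powr (c * real j)"
      by linarith
    then have "2 ^ (3 * j) * 2 ^ j' \<le> C * real j ^ 8 * 2 ^ (4 * j) * 2 powr (c * real j)"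
      using j1 by (simp add: power_divide power_mult_distrib divide_le_eq flip: power_mult power_add) (simp add: ac_simps)
    \<comment> \<open>One \<open>c * j\<close> comes from the sieve, the other pays for the power of
      \<open>j\<close>; hence the factor 2 in the claim.\<close>
    also have "\<dots> \<le> 2 powr (c * real j) * 2 ^ (4 * j) * 2 powr (c * real j)"
      using jJ(2) by (intro mult_right_mono) auto
    also have "(2::real) ^ (4 * j) = 2 powr real (4 * j)" by (subst powr_realpow) auto
    also have "2 powr (c * real j) * 2 powr real (4 * j) * 2 powr (c * real j) = 2 powr (real (4 * j) + 2 * (c * real j))"
      by (simp only: powr_add[symmetric]) (simp add: algebra_simps)
    finally have "2 powr real (3 * j + j') \<le> 2 powr (real (4 * j) + 2 * (c * real j))"
      by (subst powr_realpow) (simp_all add: power_add)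
    then have "real (3 * j + j') \<le> real (4 * j) + 2 * (c * real j)"
      by (subst (asm) powr_le_cancel_iff) auto
    then show "real j' \<le> real j + 2 * real j / real k" by (simp add: c_def)
  qed auto
qed

section \<open>Counting the exceptions\<close>

text \<open>The sum telescopes, as \<open>1 / j^2\<close> is at most
  \<open>2 / j - 2 / (j + 1)\<close>.\<close>

lemma sum_inverse_squares_le:
  assumes "J \<ge> 1"
  shows "(\<Sum>j\<in>{J..<N}. 1 / (real j)\<^sup>2) \<le> 2 / real J"
proof (cases "J \<le> N")
  case True
  have "(\<Sum>j\<in>{J..<N}. 1 / (real j)\<^sup>2) \<le> 2 / real J - 2 / real N"
    using True
  proof (induction N rule: dec_induct)
    case (step N)
    have "N > 0" using step assms by simp
    have "1 / (real N)\<^sup>2 \<le> 2 / real N - 2 / real (Suc N)"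
    proof -
      have "2 / real N - 2 / real (Suc N) = 2 / (real N * real (Suc N))"
        using \<open>N > 0\<close> by (simp add: field_simps)
      moreover have "2 / (real N * (2 * real N)) \<le> 2 / (real N * real (Suc N))"
        using \<open>N > 0\<close> by (intro divide_left_mono mult_left_mono) auto
      ultimately show ?thesis by (simp add: power2_eq_square)
    qed
    then show ?case using step by simp
  qed simp
  also have "\<dots> \<le> 2 / real J" by simp
  finally show ?thesis .
qed simp

lemma card_unhit_block_div_le:
  assumes "j \<ge> 1"
  shows "real (card (unhit_block X j)) / 2 ^ j \<le> 2 / real j"
  using card_unhit_block_le[of X j] assms by (simp add: field_simps)

text \<open>Blocks that are not bad sum to at most \<open>2 / J\<close>. If \<open>m\<close> is the
  first bad one, all bad ones lie between \<open>m\<close> and \<open>m + 2 * m / k\<close>, and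
  each contributes at most \<open>2 / m\<close> by Chebyshev's bound.\<close>

lemma sum_unhit_blocks_le:
  assumes "k \<ge> 2"
  shows "\<exists>J0\<ge>1. \<forall>X J N. J \<ge> J0 \<longrightarrow> 4 ^ N \<le> X \<longrightarrow>
    (\<Sum>j\<in>{J..<N}. real (card (unhit_block X j)) / 2 ^ j) \<le> 4 / real k + 4 / real J"
proof -
  obtain J0 where J0: "J0 \<ge> 1" and close: "\<And>X j. j \<ge> J0 \<Longrightarrow> bad_block X j \<Longrightarrow>
    X < 2 ^ (3 * j + 3) \<and>
    (\<forall>j'. j \<le> j' \<longrightarrow> j' \<le> 2 * j \<longrightarrow> 2 ^ (j + j' + 2) \<le> X \<longrightarrow> bad_block X j'
       \<longrightarrow> real j' \<le> real j + 2 * real j / real k)"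
    using bad_blocks_close[OF assms] by metis
  show ?thesis
  proof (intro exI[of _ J0] conjI allI impI J0)
    fix X J N :: nat assume J: "J0 \<le> J" and N: "4 ^ N \<le> X"
    define B where "B = {j\<in>{J..<N}. bad_block X j}"
    define u where "u = (\<lambda>j. real (card (unhit_block X j)) / 2 ^ j)"
    have "J \<ge> 1" using J J0 by simp
    have fin: "finite B" by (simp add: B_def)
    have sB: "(\<Sum>j\<in>B. u j) \<le> 4 / real k + 2 / real J"
    proof (cases "B = {}")
      case False
      define m where "m = Min B"
      have "m \<in> B" using False fin by (simp add: m_def)
      then have m: "m \<ge> J" "m < N" "bad_block X m" by (auto simp: B_def)
      then have m1: "m \<ge> J0" "m \<ge> 1" "real m > 0" using J \<open>J \<ge> 1\<close> by linarith+
      have mB: "m \<le> j" if "j \<in> B" for j using that fin by (simp add: m_def)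
      have X: "X < 2 ^ (3 * m + 3)" using close[OF m1(1) m(3)] by blast
      have le: "real j \<le> real m + 2 * real m / real k" if j: "j \<in> B" for j
      proof -
        have jN: "j < N" "bad_block X j" using j by (auto simp: B_def)
        have four: "(4::nat) ^ N = 2 ^ (2 * N)" by (simp add: power_mult)
        \<comment> \<open>This checks the side conditions of \<open>close\<close>:
          \<open>2 * N < 3 * m + 3\<close> gives \<open>j\<close> at most \<open>2 * m\<close>, and
          \<open>m\<close>, \<open>j\<close> below \<open>N\<close> give \<open>m + j + 2\<close> at
          most \<open>2 * N\<close>.\<close>
        have "2 ^ (2 * N) < (2::nat) ^ (3 * m + 3)" using X N unfolding four by linarith
        then have "2 * N < 3 * m + 3" by (rule power_less_imp_less_exp[rotated]) simp
        then have "j \<le> 2 * m" using jN m1 by linarith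
        moreover have "2 ^ (m + j + 2) \<le> (2::nat) ^ (2 * N)"
          using jN m by (intro power_increasing) auto
        then have "2 ^ (m + j + 2) \<le> X" using N unfolding four by linarith
        ultimately show ?thesis using close[OF m1(1) m(3)] mB[OF j] jN by blast
      qed
      define w where "w = nat \<lfloor>2 * real m / real k\<rfloor>"
      have w: "real w \<le> 2 * real m / real k" by (simp add: w_def)
      have "B \<subseteq> {m..m + w}"
      proof
        fix j assume j: "j \<in> B"
        have "real (j - m) \<le> 2 * real m / real k" using le[OF j] mB[OF j] by (simp add: of_nat_diff)
        then have "j - m \<le> w" by (simp add: w_def le_nat_floor)
        then show "j \<in> {m..m + w}" using mB[OF j] by auto
      qed
      then have "card B \<le> card {m..m + w}" by (intro card_mono) auto
      then have "real (card B) \<le> real w + 1" by simp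
      then have cardB: "real (card B) \<le> 2 * real m / real k + 1" using w by linarith
      have "(\<Sum>j\<in>B. u j) \<le> (\<Sum>j\<in>B. 2 / real m)"
      proof (intro sum_mono)
        fix j assume j: "j \<in> B"
        have "u j \<le> 2 / real j"
          unfolding u_def using mB[OF j] m1 by (intro card_unhit_block_div_le) auto
        also have "\<dots> \<le> 2 / real m" using mB[OF j] m1 by (intro divide_left_mono) auto
        finally show "u j \<le> 2 / real m" .
      qed
      also have "\<dots> = real (card B) * (2 / real m)" by simp
      also have "\<dots> \<le> (2 * real m / real k + 1) * (2 / real m)"
        using cardB m1 by (intro mult_right_mono) auto
      also have "\<dots> = 4 / real k + 2 / real m" using m1 assms by (simp add: field_simps)
      also have "2 / real m \<le> 2 / real J" using m \<open>J \<ge> 1\<close> by (intro divide_left_mono) auto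
      finally show ?thesis by simp
    qed simp
    have "(\<Sum>j\<in>{J..<N} - B. u j) \<le> (\<Sum>j\<in>{J..<N} - B. 1 / (real j)\<^sup>2)"
    proof (intro sum_mono)
      fix j assume "j \<in> {J..<N} - B"
      then have "\<not> bad_block X j" "j \<ge> 1" using \<open>J \<ge> 1\<close> by (auto simp: B_def)
      then show "u j \<le> 1 / (real j)\<^sup>2" by (simp add: u_def bad_block_def field_simps not_less)
    qed
    also have "\<dots> \<le> (\<Sum>j\<in>{J..<N}. 1 / (real j)\<^sup>2)" by (intro sum_mono2) auto
    also have "\<dots> \<le> 2 / real J" by (rule sum_inverse_squares_le[OF \<open>J \<ge> 1\<close>])
    finally have "(\<Sum>j\<in>{J..<N} - B. u j) \<le> 2 / real J" .
    moreover have "(\<Sum>j\<in>{J..<N}. u j) = (\<Sum>j\<in>{J..<N} - B. u j) + (\<Sum>j\<in>B. u j)"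
      by (rule sum.subset_diff) (auto simp: B_def)
    ultimately show "(\<Sum>j\<in>{J..<N}. real (card (unhit_block X j)) / 2 ^ j) \<le> 4 / real k + 4 / real J"
      using sB by (simp add: u_def)
  qed
qed

text \<open>Here \<open>q\<close> times the gcd divides \<open>n\<close>. So if \<open>q ^ i\<close>
  divides both \<open>n\<close> and \<open>a_seq (n - 1)\<close>, it divides the gcd, and
  \<open>q ^ Suc i\<close> divides \<open>n\<close>; this climbs up to \<open>K\<close>.\<close>

lemma prime_power_Suc_dvd:
  assumes "prime q" "q dvd b_seq n" "q ^ K dvd a_seq (n - 1)"
  shows "q ^ Suc K dvd n"
proof -
  let ?g = "gcd n (a_seq (n - 1))"
  have "q * ?g dvd b_seq n * ?g" using assms(2) by (intro mult_dvd_mono) auto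
  then have g: "q * ?g dvd n" by (simp add: b_seq_def)
  have "q ^ Suc i dvd n" if "i \<le> K" for i
    using that
  proof (induction i)
    case 0
    then show ?case using g by (auto intro: dvd_trans[OF dvd_triv_left])
  next
    case (Suc i)
    have "q ^ Suc i dvd a_seq (n - 1)"
      using Suc.prems le_imp_power_dvd[of "Suc i" K q] assms(3) dvd_trans by blast
    then have "q ^ Suc i dvd ?g" using Suc by simp
    then have "q * q ^ Suc i dvd q * ?g" by (rule mult_dvd_mono[OF dvd_refl])
    then show ?case using g dvd_trans by (metis power_Suc)
  qed
  then show ?thesis by blast
qed

lemma b_seq_dvd: "b_seq n dvd n"
  by (metis b_seq_def dvd_div_mult_self dvd_triv_left gcd_dvd1)

lemma composite_two_primes:
  fixes b :: nat
  assumes "b > 1" "\<not> prime b"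
  obtains p q where "prime p" "prime q" "q \<le> p" "q * p dvd b"
proof -
  obtain p where p: "prime p" "p dvd b" using prime_factor_nat[of b] assms by auto
  then obtain c where c: "b = p * c" by blast
  then have "c \<noteq> 1" using assms p by auto
  then obtain q where q: "prime q" "q dvd c" using prime_factor_nat by blast
  then have "p * q dvd b" "q * p dvd b" by (auto simp: c mult.commute)
  then show ?thesis using that[of p q] that[of q p] p q by (cases "q \<le> p") auto
qed

text \<open>Choose primes \<open>q\<close> and \<open>p\<close>, \<open>q\<close> not the larger,
  with \<open>q * p dvd b_seq n\<close>. Distinguish whether \<open>q\<close> exceeds
  \<open>Q\<close> and, if so, whether it divides \<open>a_seq X\<close>.\<close>

lemma exceptional_cases:
  assumes n: "n \<ge> 2" "X < n" "X \<ge> 1" and b: "b_seq n \<notin> {1} \<union> {p. prime p}"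
    and K: "\<And>q. prime q \<Longrightarrow> q \<le> Q \<Longrightarrow> q ^ K dvd a_seq X"
  obtains q where "prime q" "q \<le> Q" "q ^ Suc K dvd n"
    | q where "q > Q" "q\<^sup>2 dvd n"
    | q where "prime q" "q > Q" "q\<^sup>2 \<le> n" "\<not> q dvd a_seq X" "q dvd n"
proof -
  have "b_seq n \<noteq> 0" using b_seq_dvd[of n] n by (metis dvd_0_left_iff not_numeral_le_zero)
  then have "b_seq n > 1" "\<not> prime (b_seq n)" using b by (auto simp: nat_neq_iff)
  then obtain p q where pq: "prime p" "prime q" "q \<le> p" "q * p dvd b_seq n"
    by (rule composite_two_primes)
  have qb: "q dvd b_seq n" using pq(4) dvd_mult_left by blast
  have qpn: "q * p dvd n" using pq(4) b_seq_dvd dvd_trans by blast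
  have aX: "a_seq X dvd a_seq (n - 1)" using n by (intro a_seq_dvd) auto
  consider "q \<le> Q" | "q > Q" "q dvd a_seq X" | "q > Q" "\<not> q dvd a_seq X" by linarith
  then show ?thesis
  proof cases
    case 1
    then have "q ^ K dvd a_seq (n - 1)" using K[OF pq(2)] aX dvd_trans by blast
    then show ?thesis using that(1) prime_power_Suc_dvd[OF pq(2) qb] pq(2) 1 by blast
  next
    case 2
    then have "q ^ 1 dvd a_seq (n - 1)" using aX dvd_trans by simp
    then have "q ^ Suc 1 dvd n" by (rule prime_power_Suc_dvd[OF pq(2) qb])
    then show ?thesis using that(2)[of q] 2 by (simp add: power2_eq_square)
  next
    case 3
    have "q * q \<le> q * p" using pq(3) by simp
    also have "\<dots> \<le> n" using qpn n by (intro dvd_imp_le) auto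
    finally show ?thesis using that(3)[of q] 3 pq(2) qpn dvd_mult_left by (auto simp: power2_eq_square)
  qed
qed

section \<open>Union bound for the exceptions\<close>

lemma card_multiples_le:
  fixes d m :: nat
  assumes "d > 0"
  shows "real (card {n\<in>{1..m}. d dvd n}) \<le> real m / real d"
proof -
  have "{n\<in>{1..m}. d dvd n} \<subseteq> (\<lambda>i. d * i) ` {1..m div d}"
  proof
    fix n assume "n \<in> {n\<in>{1..m}. d dvd n}"
    then obtain i where i: "n = d * i" "1 \<le> n" "n \<le> m" by auto
    then have "i \<ge> 1" "i \<le> m div d"
      using assms by (auto simp: less_eq_div_iff_mult_less_eq mult.commute Suc_le_eq)
    then show "n \<in> (\<lambda>i. d * i) ` {1..m div d}" using i by auto
  qed
  then have "card {n\<in>{1..m}. d dvd n} \<le> card {1..m div d}" by (rule surj_card_le[rotated]) simp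
  then have "real (card {n\<in>{1..m}. d dvd n}) \<le> real (m div d)" by simp
  also have "\<dots> \<le> real m / real d" by (rule of_nat_div_le_of_nat)
  finally show ?thesis .
qed

lemma card_UN_multiples_le:
  fixes D :: "nat set" and m :: nat
  assumes "finite D" "\<And>d. d \<in> D \<Longrightarrow> f d > 0"
  shows "real (card (\<Union>d\<in>D. {n\<in>{1..m}. f d dvd n})) \<le> real m * (\<Sum>d\<in>D. 1 / real (f d))"
proof -
  have "real (card (\<Union>d\<in>D. {n\<in>{1..m}. f d dvd n})) \<le> real (\<Sum>d\<in>D. card {n\<in>{1..m}. f d dvd n})"
    by (intro of_nat_mono card_UN_le assms)
  also have "\<dots> = (\<Sum>d\<in>D. real (card {n\<in>{1..m}. f d dvd n}))" by simp
  also have "\<dots> \<le> (\<Sum>d\<in>D. real m / real (f d))"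
    by (intro sum_mono card_multiples_le assms)
  finally show ?thesis by (simp add: sum_distrib_left)
qed

lemma sum_UN_le:
  fixes f :: "'a \<Rightarrow> real"
  assumes "finite I" "\<And>i. i \<in> I \<Longrightarrow> finite (A i)" "\<And>x. f x \<ge> 0"
  shows "sum f (\<Union>i\<in>I. A i) \<le> (\<Sum>i\<in>I. sum f (A i))"
  using assms(1,2)
proof (induction I rule: finite_induct)
  case (insert i I)
  have "sum f (A i \<union> (\<Union>i\<in>I. A i)) \<le> sum f (A i) + sum f (\<Union>i\<in>I. A i)"
    using insert by (subst sum_Un) (auto intro!: sum_nonneg assms(3))
  then show ?case using insert by simp
qed simp

text \<open>Numbers up to \<open>X\<close> are discarded; the others fall into the three cases of
  \<open>exceptional_cases\<close> with \<open>Q = 2 ^ J\<close>, collected in \<open>E1\<close>,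
  \<open>E2\<close> and \<open>E3\<close>.\<close>

lemma exceptional_count_le:
  fixes m X J K M :: nat
  assumes X: "X \<ge> 1" and J: "J \<ge> 1" and M: "m \<le> 4 ^ M"
    and K: "\<And>q. prime q \<Longrightarrow> q \<le> 2 ^ J \<Longrightarrow> q ^ K dvd a_seq X"
  shows "real (card {n. 2 \<le> n \<and> n \<le> m \<and> b_seq n \<notin> {1} \<union> {p. prime p}})
    \<le> real X + real m * (2 ^ J / 2 ^ K + 2 / real J
         + (\<Sum>j\<in>{J..<M}. real (card (unhit_block X j)) / 2 ^ j))"
proof -
  define E1 where "E1 = (\<Union>q\<in>{2..2^J}. {n\<in>{1..m}. q ^ Suc K dvd n})"
  define E2 where "E2 = (\<Union>q\<in>{2^J<..<Suc m}. {n\<in>{1..m}. q\<^sup>2 dvd n})"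
  define U where "U = (\<Union>j\<in>{J..<M}. unhit_block X j)"
  define E3 where "E3 = (\<Union>q\<in>U. {n\<in>{1..m}. q dvd n})"
  have finU: "finite U" by (simp add: U_def)
  have Upos: "q > 0" if "q \<in> U" for q using that by (auto simp: U_def unhit_block_def)
  have "{n. 2 \<le> n \<and> n \<le> m \<and> b_seq n \<notin> {1} \<union> {p. prime p}} \<subseteq> {1..X} \<union> (E1 \<union> (E2 \<union> E3))"
  proof
    fix n assume "n \<in> {n. 2 \<le> n \<and> n \<le> m \<and> b_seq n \<notin> {1} \<union> {p. prime p}}"
    then have n: "2 \<le> n" "n \<le> m" "b_seq n \<notin> {1} \<union> {p. prime p}" by auto
    show "n \<in> {1..X} \<union> (E1 \<union> (E2 \<union> E3))"
    proof (cases "n \<le> X")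
      case False
      then have "X < n" by simp
      from n(1) this X n(3) K show ?thesis
      proof (rule exceptional_cases)
        fix q assume "prime q" "q \<le> 2 ^ J" "q ^ Suc K dvd n"
        then have "n \<in> E1" unfolding E1_def using n prime_ge_2_nat by auto
        then show ?thesis by simp
      next
        fix q assume q: "q > 2 ^ J" "q\<^sup>2 dvd n"
        have "q \<le> q\<^sup>2" by (simp add: power2_eq_square)
        also have "\<dots> \<le> n" using q n by (intro dvd_imp_le) auto
        finally have "n \<in> E2" unfolding E2_def using n q by auto
        then show ?thesis by simp
      next
        fix q assume q: "prime q" "q > 2 ^ J" "q\<^sup>2 \<le> n" "\<not> q dvd a_seq X" "q dvd n"
        have ex: "\<exists>j. q \<le> 2 * 2 ^ j" using less_exp[of q] by (intro exI[of _ q]) linarith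
        \<comment> \<open>This indexes the dyadic block of \<open>q\<close>. Minimality is applied
          at \<open>j - 1\<close>, a genuine predecessor because \<open>j\<close> is at least
          \<open>J\<close> and \<open>J\<close> at least 1.\<close>
        define j where "j = (LEAST j. q \<le> 2 * 2 ^ j)"
        have jq: "q \<le> 2 * 2 ^ j" unfolding j_def using ex by (rule LeastI_ex)
        have "2 ^ J < (2::nat) ^ Suc j" using q(2) jq by simp
        then have Jj: "J \<le> j" using power_less_imp_less_exp[of "2::nat" J "Suc j"] by simp
        then have "\<not> q \<le> 2 * 2 ^ (j - 1)"
          using not_less_Least[of "j - 1" "\<lambda>j. q \<le> 2 * 2 ^ j"] J unfolding j_def by force
        moreover have "(2::nat) ^ j = 2 * 2 ^ (j - 1)" using Jj J by (cases j) auto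
        ultimately have jq': "2 ^ j < q" by simp
        have "(2::nat) ^ (2 * j) = (2 ^ j)\<^sup>2" by (simp add: mult.commute flip: power_mult)
        also have "\<dots> < q\<^sup>2" using jq' by (intro power_strict_mono) auto
        also have "\<dots> \<le> 4 ^ M" using q n M by linarith
        also have "\<dots> = 2 ^ (2 * M)" by (simp add: power_mult)
        finally have "j < M" using power_less_imp_less_exp[of "2::nat" "2*j" "2*M"] by simp
        then have "q \<in> U" unfolding U_def unhit_block_def using Jj jq jq' q by auto
        then have "n \<in> E3" unfolding E3_def using n q by auto
        then show ?thesis by simp
      qed
    qed (use n in auto)
  qed
  then have "card {n. 2 \<le> n \<and> n \<le> m \<and> b_seq n \<notin> {1} \<union> {p. prime p}} \<le> card ({1..X} \<union> (E1 \<union> (E2 \<union> E3)))"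
    by (rule card_mono[rotated]) (auto simp: E1_def E2_def E3_def finU)
  also have "\<dots> \<le> card {1..X} + (card E1 + (card E2 + card E3))"
    by (intro order_trans[OF card_Un_le] add_mono order_refl)
  finally have total: "real (card {n. 2 \<le> n \<and> n \<le> m \<and> b_seq n \<notin> {1} \<union> {p. prime p}})
      \<le> real X + (real (card E1) + (real (card E2) + real (card E3)))"
    by simp
  have "real (card E1) \<le> real m * (\<Sum>q\<in>{2..2^J}. 1 / real (q ^ Suc K))"
    unfolding E1_def by (rule card_UN_multiples_le) auto
  also have "\<dots> \<le> real m * (2 ^ J / 2 ^ K)"
  proof (intro mult_left_mono)
    have "(\<Sum>q\<in>{2..2^J}. 1 / real (q ^ Suc K)) \<le> (\<Sum>q\<in>{2..(2::nat)^J}. 1 / 2 ^ K)"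
    proof (intro sum_mono divide_left_mono)
      fix q :: nat assume q: "q \<in> {2..2^J}"
      have "(2::real) ^ K \<le> real q ^ K" using q by (intro power_mono) auto
      also have "\<dots> \<le> real q ^ Suc K" using q by (intro power_increasing) auto
      finally show "2 ^ K \<le> real (q ^ Suc K)" by simp
    qed auto
    also have "\<dots> \<le> 2 ^ J * (1 / 2 ^ K)"
    proof -
      have "real (card {2..(2::nat)^J}) \<le> real (2 ^ J)" by (intro of_nat_mono) simp
      then have "real (card {2..(2::nat)^J}) * (1 / 2 ^ K) \<le> 2 ^ J * (1 / 2 ^ K)"
        by (intro mult_right_mono) auto
      then show ?thesis by simp
    qed
    finally show "(\<Sum>q\<in>{2..2^J}. 1 / real (q ^ Suc K)) \<le> 2 ^ J / 2 ^ K" by simp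
  qed auto
  finally have E1: "real (card E1) \<le> real m * (2 ^ J / 2 ^ K)" .
  have "real (card E2) \<le> real m * (\<Sum>q\<in>{2^J<..<Suc m}. 1 / real (q\<^sup>2))"
    unfolding E2_def by (rule card_UN_multiples_le) auto
  also have "\<dots> \<le> real m * (2 / real J)"
  proof (intro mult_left_mono)
    have "{2 ^ J<..<Suc m} \<subseteq> {J..<Suc m}"
    proof
      fix q assume "q \<in> {2 ^ J<..<Suc m}"
      then have "2 ^ J < q" "q < Suc m" by simp_all
      then show "q \<in> {J..<Suc m}"
        using less_exp[of J] unfolding atLeastLessThan_iff by (intro conjI) linarith+
    qed
    then have "(\<Sum>q\<in>{2^J<..<Suc m}. 1 / real (q\<^sup>2)) \<le> (\<Sum>q\<in>{J..<Suc m}. 1 / real (q\<^sup>2))"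
      by (intro sum_mono2) auto
    also have "\<dots> \<le> 2 / real J" using sum_inverse_squares_le[OF J, of "Suc m"] by simp
    finally show "(\<Sum>q\<in>{2^J<..<Suc m}. 1 / real (q\<^sup>2)) \<le> 2 / real J" .
  qed auto
  finally have E2: "real (card E2) \<le> real m * (2 / real J)" .
  have "real (card E3) \<le> real m * (\<Sum>q\<in>U. 1 / real q)"
    unfolding E3_def by (rule card_UN_multiples_le) (use finU Upos in auto)
  also have "\<dots> \<le> real m * (\<Sum>j\<in>{J..<M}. real (card (unhit_block X j)) / 2 ^ j)"
  proof (intro mult_left_mono)
    have "(\<Sum>q\<in>U. 1 / real q) \<le> (\<Sum>j\<in>{J..<M}. \<Sum>q\<in>unhit_block X j. 1 / real q)"
      unfolding U_def by (rule sum_UN_le) auto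
    also have "\<dots> \<le> (\<Sum>j\<in>{J..<M}. \<Sum>q\<in>unhit_block X j. 1 / 2 ^ j)"
    proof (intro sum_mono divide_left_mono)
      fix j q assume "q \<in> unhit_block X j"
      then have "2 ^ j < q" by (simp add: unhit_block_def)
      then have "real (2 ^ j) < real q" by (rule of_nat_less_iff[THEN iffD2])
      then show "2 ^ j \<le> real q" "0 < real q * 2 ^ j" by (auto intro: le_less_trans[of 0])
    qed auto
    finally show "(\<Sum>q\<in>U. 1 / real q) \<le> (\<Sum>j\<in>{J..<M}. real (card (unhit_block X j)) / 2 ^ j)" by simp
  qed auto
  finally have E3: "real (card E3) \<le> real m * (\<Sum>j\<in>{J..<M}. real (card (unhit_block X j)) / 2 ^ j)" .
  show ?thesis using total E1 E2 E3 by (simp add: algebra_simps)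
qed

section \<open>Choice of parameters\<close>

lemma eventually_prime_powers_dvd_a_seq:
  "\<exists>X0\<ge>1. \<forall>X\<ge>X0. \<forall>q. prime q \<longrightarrow> q \<le> Q \<longrightarrow> q ^ K dvd a_seq X"
proof -
  obtain f where f: "\<And>q. prime q \<Longrightarrow> f q \<ge> 1 \<and> q ^ K dvd a_seq (f q)"
  proof -
    have "\<forall>q. \<exists>N. prime q \<longrightarrow> N \<ge> 1 \<and> q ^ K dvd a_seq N" using prime_power_dvd_a_seq by blast
    then show ?thesis using that choice[of "\<lambda>q N. prime q \<longrightarrow> N \<ge> 1 \<and> q ^ K dvd a_seq N"] by blast
  qed
  define X0 where "X0 = Max (insert 1 (f ` {..Q}))"
  have "q ^ K dvd a_seq X" if "X \<ge> X0" "prime q" "q \<le> Q" for X q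
  proof -
    have "f q \<le> X0" unfolding X0_def using that by (intro Max_ge) auto
    then have "a_seq (f q) dvd a_seq X" using f[OF that(2)] that(1) by (intro a_seq_dvd) auto
    then show ?thesis using f[OF that(2)] dvd_trans by blast
  qed
  moreover have "X0 \<ge> 1" unfolding X0_def by (intro Max_ge) auto
  ultimately show ?thesis by blast
qed

lemma exists_floor_power:
  fixes X :: nat
  assumes "X \<ge> 4 ^ N0"
  obtains N :: nat where "N \<ge> N0" "4 ^ N \<le> X" "X < 4 ^ Suc N"
proof -
  define N where "N = (GREATEST N. 4 ^ N \<le> X)"
  have bound: "\<forall>N. 4 ^ N \<le> X \<longrightarrow> N \<le> X"
  proof (intro allI impI)
    fix N :: nat assume "4 ^ N \<le> X"
    moreover have "N < 2 ^ N" by (rule less_exp)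
    moreover have "(2::nat) ^ N \<le> 4 ^ N" by (intro power_mono) auto
    ultimately show "N \<le> X" by linarith
  qed
  have "4 ^ N \<le> X" unfolding N_def using GreatestI_nat[of "\<lambda>N. 4 ^ N \<le> X", OF assms] bound by blast
  moreover have "N0 \<le> N" unfolding N_def using Greatest_le_nat[of "\<lambda>N. 4 ^ N \<le> X", OF assms] bound by blast
  moreover have "Suc N \<le> N" if "4 ^ Suc N \<le> X"
    using Greatest_le_nat[where P = "\<lambda>N. 4 ^ N \<le> X" and b = X, OF that] bound
    unfolding N_def[symmetric] by blast
  then have "\<not> 4 ^ Suc N \<le> X" using Suc_n_not_le_n by blast
  ultimately show ?thesis using that by simp
qed

text \<open>This serves the blocks between \<open>sqrt X\<close> and \<open>sqrt m\<close>, where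
  \<open>sum_unhit_blocks_le\<close> does not apply. Their number is bounded in terms of
  \<open>m / X\<close>, so Chebyshev's bound suffices once \<open>N\<close> is large.\<close>

lemma sum_unhit_blocks_top_le:
  assumes "N \<ge> 1"
  shows "(\<Sum>j\<in>{N..<N+L}. real (card (unhit_block X j)) / 2 ^ j) \<le> 2 * real L / real N"
proof -
  have "(\<Sum>j\<in>{N..<N+L}. real (card (unhit_block X j)) / 2 ^ j) \<le> (\<Sum>j\<in>{N..<N+L}. 2 / real N)"
  proof (intro sum_mono)
    fix j assume j: "j \<in> {N..<N+L}"
    have "real (card (unhit_block X j)) / 2 ^ j \<le> 2 / real j"
      using j assms by (intro card_unhit_block_div_le) auto
    also have "\<dots> \<le> 2 / real N" using j assms by (intro divide_left_mono) auto
    finally show "real (card (unhit_block X j)) / 2 ^ j \<le> 2 / real N" .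
  qed
  then show ?thesis by (simp add: mult.commute)
qed

text \<open>With \<open>X\<close> about \<open>e * x\<close>, five quantities of size at most
  \<open>e\<close> arise: \<open>X / x\<close>, the term \<open>2 ^ J / 2 ^ K\<close>, the terms in
  \<open>1 / J\<close>, the term \<open>4 / k\<close> from the sieve, and the top blocks.\<close>

lemma exceptional_count_small:
  fixes e :: real
  assumes e: "0 < e" "e \<le> 1"
  shows "eventually (\<lambda>x. real (card {n. 2 \<le> n \<and> n \<le> nat \<lfloor>x\<rfloor> \<and> b_seq n \<notin> {1} \<union> {p. prime p}}) \<le> 5 * e * x) at_top"
proof -
  define k where "k = max 2 (nat \<lceil>4 / e\<rceil>)"
  have "real k \<ge> 4 / e" "k \<ge> 2" unfolding k_def by linarith+
  then have k: "k \<ge> 2" "4 / real k \<le> e" using e by (auto simp: field_simps)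
  obtain J0 where J0: "J0 \<ge> 1" "\<And>X J N. J \<ge> J0 \<Longrightarrow> 4 ^ N \<le> X \<Longrightarrow>
      (\<Sum>j\<in>{J..<N}. real (card (unhit_block X j)) / 2 ^ j) \<le> 4 / real k + 4 / real J"
    using sum_unhit_blocks_le[OF k(1)] by blast
  define J where "J = max J0 (nat \<lceil>8 / e\<rceil>)"
  have "real J \<ge> 8 / e" unfolding J_def by linarith
  moreover have "J \<ge> J0" "J \<ge> 1" using J0(1) by (auto simp: J_def)
  ultimately have J: "J \<ge> J0" "J \<ge> 1" "8 / real J \<le> e" using e by (auto simp: field_simps)
  obtain K where "2 ^ J / e < 2 ^ K" using real_arch_pow[of 2 "2 ^ J / e"] by auto
  then have K: "2 ^ J / 2 ^ K \<le> e" using e by (simp add: field_simps)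
  \<comment> \<open>As \<open>m\<close> is at most \<open>2 * X / e\<close>, this \<open>L\<close>
    makes \<open>m\<close> at most \<open>4 ^ (N + Suc L)\<close>, with \<open>L\<close> independent
    of \<open>x\<close>.\<close>
  obtain L where L: "2 / e < 4 ^ L" using real_arch_pow[of 4 "2 / e"] by auto
  define N0 where "N0 = max 1 (nat \<lceil>2 * real (Suc L) / e\<rceil>)"
  obtain X0 where X0: "X0 \<ge> 1" "\<And>X q. X \<ge> X0 \<Longrightarrow> prime q \<Longrightarrow> q \<le> 2 ^ J \<Longrightarrow> q ^ K dvd a_seq X"
    using eventually_prime_powers_dvd_a_seq[of "2 ^ J" K] by blast
  have "eventually (\<lambda>x. x \<ge> (real (max X0 (4 ^ N0)) + 1) / e) at_top" by (rule eventually_ge_at_top)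
  then show ?thesis
  proof eventually_elim
    case (elim x)
    define X where "X = nat \<lfloor>e * x\<rfloor>"
    define m where "m = nat \<lfloor>x\<rfloor>"
    have ex: "e * x \<ge> real (max X0 (4 ^ N0)) + 1" using elim e by (simp add: field_simps)
    then have "e * x > 0" by linarith
    then have x: "x > 0" using e by (simp add: zero_less_mult_iff)
    have X: "real X \<le> e * x" "e * x < real X + 1" using \<open>e * x > 0\<close> unfolding X_def by linarith+
    have m: "real m \<le> x" using x by (simp add: m_def)
    have "max X0 (4 ^ N0) \<le> X" using ex X by linarith
    then have XX: "X \<ge> X0" "X \<ge> 4 ^ N0" "X \<ge> 1" using X0(1) by auto
    obtain N where N: "N \<ge> N0" "4 ^ N \<le> X" "X < 4 ^ Suc N" using exists_floor_power[OF XX(2)] by blast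
    have N1: "N \<ge> 1" using N by (simp add: N0_def)
    have "real N0 \<ge> 2 * real (Suc L) / e" unfolding N0_def by linarith
    then have "real N \<ge> 2 * real (Suc L) / e" using N(1) by linarith
    then have NL: "2 * real (Suc L) / real N \<le> e" using e N1 by (simp add: field_simps)
    have "real m \<le> (e * x) / e" using m e by simp
    also have "\<dots> \<le> (2 * real X) / e" using X XX e by (intro divide_right_mono) linarith+
    also have "\<dots> = (2 / e) * real X" by simp
    also have "\<dots> \<le> 4 ^ L * real (4 ^ Suc N)"
      using L N(3) e by (intro mult_mono of_nat_mono) auto
    also have "\<dots> = real (4 ^ (N + Suc L))" by (simp add: power_add)
    finally have mM: "m \<le> 4 ^ (N + Suc L)" by (simp only: of_nat_le_iff)
    define u where "u = (\<lambda>j. real (card (unhit_block X j)) / 2 ^ j)"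
    \<comment> \<open>This is only an inequality, since \<open>N\<close> may lie below
      \<open>J\<close>.\<close>
    have "(\<Sum>j\<in>{J..<N + Suc L}. u j) \<le> (\<Sum>j\<in>{J..<N} \<union> {N..<N + Suc L}. u j)"
      by (intro sum_mono2) (auto simp: u_def)
    also have "\<dots> = (\<Sum>j\<in>{J..<N}. u j) + (\<Sum>j\<in>{N..<N + Suc L}. u j)"
      by (intro sum.union_disjoint) auto
    also have "(\<Sum>j\<in>{J..<N}. u j) \<le> 4 / real k + 4 / real J"
      unfolding u_def by (rule J0(2)[OF J(1) N(2)])
    also have "(\<Sum>j\<in>{N..<N + Suc L}. u j) \<le> 2 * real (Suc L) / real N"
      unfolding u_def by (rule sum_unhit_blocks_top_le[OF N1])
    finally have su: "(\<Sum>j\<in>{J..<N + Suc L}. u j) \<le> 2 * e + 4 / real J" using k NL by linarith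
    have "real (card {n. 2 \<le> n \<and> n \<le> m \<and> b_seq n \<notin> {1} \<union> {p. prime p}})
        \<le> real X + real m * (2 ^ J / 2 ^ K + 2 / real J + (\<Sum>j\<in>{J..<N + Suc L}. u j))"
      unfolding u_def by (rule exceptional_count_le[OF XX(3) J(2) mM X0(2)[OF XX(1)]])
    also have "\<dots> \<le> real X + real m * (4 * e)"
    proof (intro add_left_mono mult_left_mono)
      have "2 / real J + 4 / real J \<le> 8 / real J" by (simp add: divide_right_mono flip: add_divide_distrib)
      then show "2 ^ J / 2 ^ K + 2 / real J + (\<Sum>j\<in>{J..<N + Suc L}. u j) \<le> 4 * e"
        using su K J(3) by linarith
    qed simp
    also have "\<dots> \<le> e * x + x * (4 * e)" using X m e by (intro add_mono mult_right_mono) auto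
    finally show ?case by (simp add: m_def algebra_simps)
  qed
qed

theorem theorem6p1:
  shows "asymptotic_density_one {n::nat. n \<ge> 2 \<and> b_seq n \<in> {1} \<union> {p. prime p}}"
  unfolding asymptotic_density_one_def
proof (rule landau_o.smallI)
  fix c :: real assume c: "c > 0"
  \<comment> \<open>Five multiples of \<open>e * x\<close> pay for the exceptions, the sixth for the
    number 1 and the rounding of \<open>x\<close>, which together cost at most 2.\<close>
  define e where "e = min c 1 / 6"
  have e: "0 < e" "e \<le> 1" "6 * e \<le> c" using c by (auto simp: e_def)
  define A where "A = {n::nat. n \<ge> 2 \<and> b_seq n \<in> {1} \<union> {p. prime p}}"
  have "eventually (\<lambda>x. x \<ge> 2 / e) at_top" by (rule eventually_ge_at_top)
  with exceptional_count_small[OF e(1,2)]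
  show "\<forall>\<^sub>F x in at_top. norm (x - real (card {n \<in> {n. 2 \<le> n \<and> b_seq n \<in> {1} \<union> {p. prime p}}. real n \<le> x})) \<le> c * norm x"
  proof eventually_elim
    case (elim x)
    define m where "m = nat \<lfloor>x\<rfloor>"
    define G where "G = {n \<in> A. real n \<le> x}"
    define B where "B = {n. 2 \<le> n \<and> n \<le> m \<and> b_seq n \<notin> {1} \<union> {p. prime p}}"
    have "2 / e > 0" using e by simp
    then have x: "x > 0" using elim(2) by linarith
    have ex: "2 \<le> e * x" using elim(2) e by (simp add: field_simps)
    have nm: "real n \<le> x \<longleftrightarrow> n \<le> m" for n
      using x by (simp add: m_def le_nat_floor nat_le_iff le_floor_iff) linarith
    have mx: "real m \<le> x" "x < real m + 1" using x unfolding m_def by linarith+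
    have G: "G \<subseteq> {1..m}" by (auto simp: G_def A_def nm)
    have "card G \<le> card {1..m}" using G by (intro card_mono) auto
    then have Gle: "real (card G) \<le> x" using mx by simp
    have fin: "finite G" "finite B" using G by (auto simp: B_def intro: finite_subset)
    have "{1..m} \<subseteq> {1} \<union> (G \<union> B)" by (auto simp: G_def B_def A_def nm)
    then have "card {1..m} \<le> card ({1} \<union> (G \<union> B))" using fin by (intro card_mono) auto
    also have "\<dots> \<le> card {1::nat} + (card G + card B)"
      by (intro order_trans[OF card_Un_le] add_mono order_refl)
    finally have "real m \<le> 1 + real (card G) + real (card B)" by simp
    moreover have "real (card B) \<le> 5 * e * x" using elim(1) by (simp add: B_def m_def)
    ultimately have "x - real (card G) \<le> 6 * e * x" using mx ex by linarith
    also have "\<dots> \<le> c * x" using e x by (intro mult_right_mono) auto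
    finally have "norm (x - real (card G)) \<le> c * norm x" using Gle x by simp
    then show ?case by (simp add: G_def A_def)
  qed
qed

end
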